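(* Let $B=\{B(t):t\ge 0\}$ be standard Brownian Motion with $B(0)=0$, let $M(t)=\max_{0\le s\le t}B(s)$, $m(t)=\min_{0\le s\le t}B(s)$, $D(t)=M(t)-m(t)$, and for $d>0$ let $$\mathcal{T}_d=\inf\{t\ge 0: (M(t)-B(t))\wedge(B(t)-m(t))\ge d\}.$$ Then for every $c>0$: (i) The stopping time $\mathcal{T}_{1/(2c)}$ is optimal for the $c$-problem with reward function $R(t)=D(t)$; that is, $E[D(\tau)-c\tau]\le E[D(\mathcal{T}_{1/(2c)})-c\,\mathcal{T}_{1/(2c)}]$ for every stopping time $\tau$ with $E[\tau]<\infty$. Moreover, it is the unique optimal stopping time within the family $\{\mathcal{T}_d: d>0\}$. (ii) $E[\mathcal{T}_{1/(2c)}]=\dfrac{3}{4c^2}$. (iii) The optimal expected payoff is $E[D(\mathcal{T}_{1/(2c)})-c\,\mathcal{T}_{1/(2c)}]=\dfrac{3}{4c}$.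
   Context: Stopping times are with respect to the filtration $\{\mathcal{B}_t\}$ of $B$. Given a reward process $R(t)$ and a cost rate $c>0$, the $c$-problem is the problem of maximizing $E[R(\tau)-c\tau]$ over stopping times $\tau$ of $B$ with $E[\tau]<\infty$; a stopping time is optimal if it attains the maximum. Here $a\wedge b=\min(a,b)$. *)

theory Defs
  imports "HOL-Probability.Probability"
begin

text \<open>
  A process is a function of a time \<open>t :: real\<close> and a sample point; only its values at
  \<open>t \<ge> 0\<close> matter. Every path (not just almost every path) starts at 0 and is continuous.
\<close>

locale brownian_motion = prob_space M
  for M :: "'a measure" +
  fixes B :: "real \<Rightarrow> 'a \<Rightarrow> real"
  assumes measurable_B: "\<And>t. 0 \<le> t \<Longrightarrow> B t \<in> borel_measurable M"
    and B_0: "\<And>\<omega>. \<omega> \<in> space M \<Longrightarrow> B 0 \<omega> = 0"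
    and continuous_paths: "\<And>\<omega>. \<omega> \<in> space M \<Longrightarrow> continuous_on {0..} (\<lambda>t. B t \<omega>)"
    and normal_increments: "\<And>s t. 0 \<le> s \<Longrightarrow> s < t \<Longrightarrow>
      distributed M lborel (\<lambda>\<omega>. B t \<omega> - B s \<omega>) (normal_density 0 (sqrt (t - s)))"
    and indep_increments: "\<And>(n::nat) t. 0 \<le> t 0 \<Longrightarrow> (\<And>i. i < n \<Longrightarrow> t i < t (Suc i)) \<Longrightarrow>
      indep_vars (\<lambda>_. borel) (\<lambda>i \<omega>. B (t (Suc i)) \<omega> - B (t i) \<omega>) {..<n}"

text \<open>
  Stopping times may take the value \<open>\<infinity>\<close>, so they have type \<open>'a \<Rightarrow> ennreal\<close>. The library's
  \<^const>\<open>stopping_time\<close> uses one type for the values of the stopping time and the indices of the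
  filtration, so the filtration generated by \<open>B\<close> is indexed by \<^typ>\<open>ennreal\<close> as well; at the
  index \<open>\<infinity>\<close> it is generated by the whole process.
\<close>

definition natural_filtration ::
  "'a measure \<Rightarrow> (real \<Rightarrow> 'a \<Rightarrow> real) \<Rightarrow> ennreal \<Rightarrow> 'a measure" where
  "natural_filtration M B t =
     sigma (space M) {B s -` A \<inter> space M | s A. 0 \<le> s \<and> ennreal s \<le> t \<and> A \<in> sets borel}"

definition admissible ::
  "'a measure \<Rightarrow> (real \<Rightarrow> 'a \<Rightarrow> real) \<Rightarrow> ('a \<Rightarrow> ennreal) \<Rightarrow> bool" where
  "admissible M B \<tau> \<longleftrightarrow>
     stopping_time (natural_filtration M B) \<tau> \<and> (\<integral>\<^sup>+ \<omega>. \<tau> \<omega> \<partial>M) < \<infinity>"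

text \<open>
  An admissible \<open>\<tau>\<close> is finite almost surely, so the value that \<^const>\<open>enn2real\<close> gives to \<open>\<infinity>\<close>
  does not affect any expectation.
\<close>

definition payoff ::
  "(real \<Rightarrow> 'a \<Rightarrow> real) \<Rightarrow> real \<Rightarrow> ('a \<Rightarrow> ennreal) \<Rightarrow> 'a \<Rightarrow> real" where
  "payoff R c \<tau> \<omega> = R (enn2real (\<tau> \<omega>)) \<omega> - c * enn2real (\<tau> \<omega>)"

text \<open>
  The Bochner integral of a non-integrable function is 0, so optimality is only meaningful
  when the payoffs of all admissible stopping times are integrable.
\<close>

definition optimal ::
  "'a measure \<Rightarrow> (real \<Rightarrow> 'a \<Rightarrow> real) \<Rightarrow> (real \<Rightarrow> 'a \<Rightarrow> real) \<Rightarrow> real \<Rightarrow> ('a \<Rightarrow> ennreal) \<Rightarrow> bool" where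
  "optimal M B R c \<tau> \<longleftrightarrow> admissible M B \<tau> \<and>
     (\<forall>\<sigma>. admissible M B \<sigma> \<longrightarrow>
        (\<integral>\<omega>. payoff R c \<sigma> \<omega> \<partial>M) \<le> (\<integral>\<omega>. payoff R c \<tau> \<omega> \<partial>M))"

text \<open>For continuous paths the supremum and infimum below are attained.\<close>

definition running_max :: "(real \<Rightarrow> 'a \<Rightarrow> real) \<Rightarrow> real \<Rightarrow> 'a \<Rightarrow> real" where
  "running_max B t \<omega> = (SUP s\<in>{0..t}. B s \<omega>)"

definition running_min :: "(real \<Rightarrow> 'a \<Rightarrow> real) \<Rightarrow> real \<Rightarrow> 'a \<Rightarrow> real" where
  "running_min B t \<omega> = (INF s\<in>{0..t}. B s \<omega>)"

definition running_range :: "(real \<Rightarrow> 'a \<Rightarrow> real) \<Rightarrow> real \<Rightarrow> 'a \<Rightarrow> real" where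
  "running_range B t \<omega> = running_max B t \<omega> - running_min B t \<omega>"

text \<open>The infimum is taken in \<^typ>\<open>ennreal\<close>, so that it is \<open>\<infinity>\<close> if the level \<open>d\<close> is never reached.\<close>

definition drawdown_drawup_time :: "(real \<Rightarrow> 'a \<Rightarrow> real) \<Rightarrow> real \<Rightarrow> 'a \<Rightarrow> ennreal" where
  "drawdown_drawup_time B d \<omega> = Inf {ennreal t | t. 0 \<le> t \<and>
     min (running_max B t \<omega> - B t \<omega>) (B t \<omega> - running_min B t \<omega>) \<ge> d}"

end

theory Submission
  imports Defs
begin

text \<open>
  Let \<open>a\<close> and \<open>b\<close> be the distances of \<open>B\<close> to its running maximum and minimum. For \<open>d = 1 / (2c)\<close>,
  \<open>potential d a b / (4d)\<close> solves the free boundary problem: it equals the range \<open>a + b\<close> where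
  \<open>min a b \<ge> d\<close>, elsewhere it is quadratic in \<open>B\<close> with second derivative \<open>2c\<close>, and it continues
  without a kink when \<open>B\<close> passes a previous extremum. As a function of the next position it is
  therefore \<open>C\<^sup>1\<close> with second derivative at most \<open>2c\<close>, so that one step \<open>\<xi>\<close> of any discretisation
  satisfies the pathwise inequality \<open>potential(next) \<le> potential + potential_deriv * \<xi> + 2 \<xi>\<^sup>2\<close> with
  bounded \<open>potential_deriv\<close>. Independence of increments kills the linear term in expectation, so no
  stochastic calculus is needed: refining the grid gives \<open>E D(\<tau>) \<le> 3d/2 + E \<tau> / (2d)\<close> for every
  \<open>d > 0\<close> and every admissible \<open>\<tau>\<close>. Up to the drawdown-drawup time \<open>T\<^sub>d\<close> the pathwise inequality is an
  equality up to errors that vanish with the mesh, so \<open>T\<^sub>d\<close> attains the bound for this \<open>d\<close>. Since it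
  satisfies the bounds for all other parameters too, \<open>E T\<^sub>d = 3d\<^sup>2\<close> and \<open>E D(T\<^sub>d) = 3d\<close>.
\<close>

subsection \<open>The potential\<close>

text \<open>The constant \<open>6 * d\<^sup>2\<close> is forced by continuity across
  \<open>a + b = 2 * d\<close>. Both gaps start at 0, so it is also the intercept of the bound:
  \<open>6 * d\<^sup>2 / (4 * d) = 3 * d / 2\<close>. The factor 2 of the squared step is half the
  second derivative 4; as a squared increment has mean equal to its time step, the squares add up to
  twice the expected time.

  For the lower bound the obstacle is a step that jumps into the region where both gaps exceed
  \<open>d\<close>, where the quadratic expansion is too large. Continuity of paths confines this to
  the last step. The other loss is the squared growth of the range, and these squares sum to at most
  the largest step times the range.

  Finiteness of the expected stopping time is not known beforehand. It follows for truncated times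
  by playing the lower bound for \<open>d\<close> against the upper bound for \<open>2 * d\<close>.

  The exact values are a tangency: with D and t the expected range and time at
  \<open>T\<^sub>d\<close>, the quadratic \<open>6 * e\<^sup>2 - 4 * e * D + 2 * t\<close> is
  nonnegative for all \<open>e > 0\<close> and vanishes at \<open>e = d\<close>, so \<open>d\<close>
  is a double root.\<close>

definition potential :: "real \<Rightarrow> real \<Rightarrow> real \<Rightarrow> real" where
  "potential d a b = (if a + b \<le> 2 * d then a\<^sup>2 + b\<^sup>2 + 6 * d\<^sup>2
     else 4 * d * (a + b) + 2 * ((max 0 (d - a))\<^sup>2 + (max 0 (d - b))\<^sup>2))"

text \<open>The derivative of \<open>potential d (a - x) (b + x)\<close> in \<open>x\<close> at 0.
  For \<open>a = 0\<close> it equals the derivative of \<open>potential d 0 b\<close> in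
  \<open>b\<close>, so pushing the maximum upwards creates no kink.\<close>

definition potential_deriv :: "real \<Rightarrow> real \<Rightarrow> real \<Rightarrow> real" where
  "potential_deriv d a b = (if a + b \<le> 2 * d then 2 * (b - a) else 4 * (max 0 (d - a) - max 0 (d - b)))"

text \<open>Reflecting the path exchanges the gaps and reverses the increment, so each step estimate
  is proved for \<open>x \<ge> 0\<close> and transferred.\<close>

lemma potential_swap:
  "potential d b a = potential d a b" "potential_deriv d b a = - potential_deriv d a b"
  by (auto simp: potential_def potential_deriv_def add.commute)

lemma potential_ge: assumes "d > 0" shows "4 * d * (a + b) \<le> potential d a b"
proof (cases "a + b \<le> 2 * d")
  case True
  \<comment> \<open>This is twice the difference of the two sides in this branch.\<close>
  have "0 \<le> (2*d - (a+b)) * (6*d - (a+b)) + (a-b)\<^sup>2"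
    using True assms by (intro add_nonneg_nonneg mult_nonneg_nonneg) auto
  with True show ?thesis by (simp add: potential_def power2_eq_square algebra_simps)
qed (simp add: potential_def)

text \<open>The majorant has no case split, so measurability and limits come term by term. Its
  corrections vanish once both gaps reach \<open>d\<close>, so nothing is lost at the stopping
  time.\<close>

lemma potential_le: assumes "d > 0" "a \<ge> 0" "b \<ge> 0"
  shows "potential d a b \<le> 4 * d * (a + b) + 2 * ((max 0 (d - a))\<^sup>2 + (max 0 (d - b))\<^sup>2)
           + 2 * d * (max 0 (d - a) + max 0 (d - b))"
proof (cases "a + b \<le> 2 * d")
  case True
  define p q where "p = max 0 (d - a)" and "q = max 0 (d - b)"
  have pq: "p \<ge> 0" "q \<ge> 0" "d - a \<le> p" "d - b \<le> q" "a - d \<le> q" "b - d \<le> p"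
    using True by (auto simp: p_def q_def)
  have "(d - a)\<^sup>2 \<le> (max p q)\<^sup>2" using pq by (intro abs_le_square_iff[THEN iffD1]) auto
  also have "\<dots> \<le> p\<^sup>2 + q\<^sup>2" by (auto simp: max_def)
  finally have 1: "(d - a)\<^sup>2 \<le> p\<^sup>2 + q\<^sup>2" .
  have "(d - b)\<^sup>2 \<le> (max p q)\<^sup>2" using pq by (intro abs_le_square_iff[THEN iffD1]) auto
  also have "\<dots> \<le> p\<^sup>2 + q\<^sup>2" by (auto simp: max_def)
  finally have 2: "(d - b)\<^sup>2 \<le> p\<^sup>2 + q\<^sup>2" .
  have 3: "2 * d * (2 * d - (a+b)) \<le> 2 * d * (p + q)"
    using pq assms by (intro mult_left_mono) auto
  have "potential d a b = 4 * d * (a + b) + (d-a)\<^sup>2 + (d-b)\<^sup>2 + 2 * d * (2 * d - (a+b))"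
    using True by (simp add: potential_def power2_eq_square algebra_simps)
  with 1 2 3 show ?thesis unfolding p_def[symmetric] q_def[symmetric] distrib_left by linarith
next
  case False
  then show ?thesis using assms by (auto simp: potential_def)
qed

lemma potential_deriv_bound: assumes "d > 0" "a \<ge> 0" "b \<ge> 0" shows "\<bar>potential_deriv d a b\<bar> \<le> 4 * d"
  using assms by (auto simp: potential_deriv_def max_def)

text \<open>In the step lemmas \<open>x\<close> is the increment of the path, so the distances become
  \<open>max (a - x) 0\<close> and \<open>max (b + x) 0\<close>.\<close>

lemma potential_step_right:
  assumes d: "d > 0" and ab: "a \<ge> 0" "b \<ge> 0" and x: "x \<ge> 0"
  shows "potential d (max (a - x) 0) (max (b + x) 0) \<le> potential d a b + potential_deriv d a b * x + 2 * x\<^sup>2"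
    (is "?l \<le> ?r")
proof (cases "x \<le> a")
  case True
  show ?thesis
  proof (cases "a + b \<le> 2 * d")
    case True
    with \<open>x \<le> a\<close> ab x show ?thesis by (simp add: potential_def potential_deriv_def power2_eq_square algebra_simps)
  next
    case False
    define p q where "p = max 0 (d - a)" and "q = max 0 (d - b)"
    have l: "?l = 4 * d * (a + b) + 2 * ((max 0 (d - a + x))\<^sup>2 + (max 0 (d - b - x))\<^sup>2)"
      using False \<open>x \<le> a\<close> ab x by (simp add: potential_def algebra_simps)
    have r: "?r = 4 * d * (a + b) + 2 * (p\<^sup>2 + q\<^sup>2 + 2 * (p - q) * x + x\<^sup>2)"
      using False by (simp add: potential_def potential_deriv_def algebra_simps p_def q_def)
    \<comment> \<open>Since \<open>a + b > 2 * d\<close>, at most one of \<open>p\<close> and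
      \<open>q\<close> is positive. For \<open>a < d\<close> both sides agree; otherwise
      \<open>p = 0\<close> and the right-hand side is \<open>(q - x)\<^sup>2\<close>.\<close>
    have "(max 0 (d - a + x))\<^sup>2 + (max 0 (d - b - x))\<^sup>2 \<le> p\<^sup>2 + q\<^sup>2 + 2 * (p - q) * x + x\<^sup>2"
    proof (cases "a < d")
      case True
      then have "p = d - a" "q = 0" "max 0 (d - b - x) = 0" "max 0 (d - a + x) = p + x"
        using False x by (auto simp: p_def q_def)
      then show ?thesis by (simp only:) (simp add: power2_eq_square algebra_simps)
    next
      case nt: False
      then have p: "p = 0" by (auto simp: p_def)
      have "(p\<^sup>2 + q\<^sup>2 + 2 * (p - q) * x + x\<^sup>2) = (q - x)\<^sup>2"
        by (simp add: p power2_eq_square algebra_simps)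
      moreover have "(max 0 (d - a + x))\<^sup>2 + (max 0 (d - b - x))\<^sup>2 \<le> (q - x)\<^sup>2"
      proof (cases "d - a + x > 0")
        case True
        then have "max 0 (d - b - x) = 0" "max 0 (d - a + x) = d - a + x" using False by auto
        \<comment> \<open>The step ends within \<open>d\<close> of the maximum. From
          \<open>a \<ge> d\<close> and \<open>a + b > 2 * d\<close> follows
          \<open>q \<le> a - d\<close>, hence \<open>x - q \<ge> d - a + x > 0\<close>.\<close>
        moreover have "\<bar>d - a + x\<bar> \<le> \<bar>q - x\<bar>" using True False nt by (auto simp: q_def)
        ultimately show ?thesis using abs_le_square_iff[of "d - a + x" "q - x"] by simp
      next
        case f2: False
        then have "max 0 (d - a + x) = 0" by auto
        moreover have "\<bar>max 0 (d - b - x)\<bar> \<le> \<bar>q - x\<bar>" using x by (auto simp: q_def)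
        ultimately show ?thesis using abs_le_square_iff[of "max 0 (d - b - x)" "q - x"] by simp
      qed
      ultimately show ?thesis by simp
    qed
    then show ?thesis unfolding l r by simp
  qed
next
  case False
  \<comment> \<open>The overshoot beyond the old maximum, which is also the growth of the
    range.\<close>
  define e where "e = x - a"
  then have e: "e > 0" "x = a + e" using False by auto
  have ns: "max (a - x) 0 = 0" "max (b + x) 0 = a + b + e" using e ab by auto
  consider "a + b + e \<le> 2 * d" | "a + b \<le> 2 * d" "2 * d < a + b + e" | "2 * d < a + b"
    by linarith
  then show ?thesis
  proof cases
    case 1
    have "?r - ?l = e\<^sup>2" using 1 e
      unfolding ns by (simp add: potential_def potential_deriv_def power2_eq_square algebra_simps)
    then show ?thesis using zero_le_power2[of e] by linarith
  next
    case 2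
    have l: "?l = 4 * d * (a + b + e) + 2 * d\<^sup>2" using 2 d unfolding ns
      by (simp add: potential_def)
    have "?r - ?l = (a + b + e - 2 * d)\<^sup>2 + e\<^sup>2" unfolding l using 2 e
      by (simp add: potential_def potential_deriv_def power2_eq_square algebra_simps)
    then show ?thesis using zero_le_power2[of e] zero_le_power2[of "a + b + e - 2 * d"] by linarith
  next
    case 3
    define p q where "p = max 0 (d - a)" and "q = max 0 (d - b)"
    have l: "?l = 4 * d * (a + b + e) + 2 * d\<^sup>2" using 3 d e unfolding ns
      by (simp add: potential_def)
    have r: "?r = 4 * d * (a + b) + 2 * (p\<^sup>2 + q\<^sup>2 + 2 * (p - q) * x + x\<^sup>2)"
      using 3 by (simp add: potential_def potential_deriv_def algebra_simps p_def q_def)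
    \<comment> \<open>If \<open>q = 0\<close>, use \<open>a + p = max a d\<close>. If
      \<open>q > 0\<close>, then \<open>p = 0\<close> and
      \<open>a - q = a + b - d > d\<close>.\<close>
    have *: "d + e \<le> x + p - q" "p * q = 0" using 3 e by (auto simp: p_def q_def max_def)
    have "(d + e)\<^sup>2 \<le> (x + p - q)\<^sup>2" using * d e by (intro power_mono) auto
    also have "\<dots> = p\<^sup>2 + q\<^sup>2 + 2 * (p - q) * x + x\<^sup>2"
      using *(2) by (simp add: power2_eq_square algebra_simps)
    finally have "d\<^sup>2 + 2 * d * e \<le> p\<^sup>2 + q\<^sup>2 + 2 * (p - q) * x + x\<^sup>2"
      using zero_le_power2[of e] unfolding power2_sum[of d e] by linarith
    then show ?thesis unfolding l r by (simp add: algebra_simps)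
  qed
qed

lemma potential_step:
  assumes d: "d > 0" and ab: "a \<ge> 0" "b \<ge> 0"
  shows "potential d (max (a - x) 0) (max (b + x) 0) \<le> potential d a b + potential_deriv d a b * x + 2 * x\<^sup>2"
proof (cases "x \<ge> 0")
  case True then show ?thesis using potential_step_right assms by blast
next
  case False
  then show ?thesis using potential_step_right[of d b a "-x"] assms
    by (simp add: potential_swap[of d b a] potential_swap[of d "max (b + x) 0"])
qed

text \<open>Meant for the step that straddles the stopping time, whose direction and size are
  arbitrary. For a range above \<open>2 * d\<close> the potential is convex in \<open>x\<close> and
  lies above its tangent; the price is the missing quadratic term.\<close>

lemma potential_step_last_right:
  assumes d: "d > 0" and ab: "a \<ge> 0" "b \<ge> 0" and D: "2 * d < a + b" and x: "x \<ge> 0"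
  shows "potential d a b + potential_deriv d a b * x \<le> potential d (max (a - x) 0) (max (b + x) 0)" (is "?l \<le> ?r")
proof -
  define p q where "p = max 0 (d - a)" and "q = max 0 (d - b)"
  have pq: "p \<ge> 0" "q \<ge> 0" "p \<le> d" "q \<le> d" using ab d by (auto simp: p_def q_def)
  have l: "?l = 4 * d * (a + b) + 2 * (p\<^sup>2 + q\<^sup>2 + 2 * (p - q) * x)"
    using D by (simp add: potential_def potential_deriv_def algebra_simps p_def q_def)
  show ?thesis
  proof (cases "x \<le> a")
    case True
    have r: "?r = 4 * d * (a + b) + 2 * ((max 0 (d - a + x))\<^sup>2 + (max 0 (d - b - x))\<^sup>2)"
      using D \<open>x \<le> a\<close> ab x by (simp add: potential_def algebra_simps)
    \<comment> \<open>The tangent inequality for the convex function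
      \<open>(max 0 u)\<^sup>2\<close>. Beyond the old maximum the potential goes on linearly with
      slope \<open>4 * d\<close>, its slope at \<open>x = a\<close>.\<close>
    have convex: "(max 0 u)\<^sup>2 + 2 * max 0 u * y \<le> (max 0 (u + y))\<^sup>2" for u y :: real
    proof (cases "u > 0")
      case True
      show ?thesis
      proof (cases "u + y > 0")
        case False
        then have "u * (u + 2 * y) \<le> 0" using True by (intro mult_nonneg_nonpos) auto
        then show ?thesis using True False by (simp add: power2_eq_square algebra_simps)
      qed (use True in \<open>simp add: power2_sum\<close>)
    qed auto
    show ?thesis unfolding l r using convex[of "d - a" x] convex[of "d - b" "-x"]
      by (simp add: p_def q_def algebra_simps)
  next
    case False
    define e where "e = x - a"
    then have e: "e > 0" "x = a + e" using False by auto
    have ns: "max (a - x) 0 = 0" "max (b + x) 0 = a + b + e" using e ab by auto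
    have r: "?r = 4 * d * (a + b + e) + 2 * d\<^sup>2" using D d e unfolding ns
      by (simp add: potential_def)
    have "p\<^sup>2 + q\<^sup>2 + 2 * (p - q) * x \<le> d\<^sup>2 + 2 * d * e"
    proof (cases "a < d")
      case True
      then have "d = p + a" "q = 0" using D by (auto simp: p_def q_def)
      moreover have "0 \<le> a * a + 2 * a * e" using ab e by simp
      ultimately show ?thesis using e by (simp add: power2_eq_square algebra_simps)
    next
      case False
      then have "p = 0" by (auto simp: p_def)
      moreover have "q\<^sup>2 \<le> d\<^sup>2" using pq by (intro power_mono) auto
      moreover have "0 \<le> q * x" "0 \<le> d * e" using pq x e d by auto
      ultimately show ?thesis by simp
    qed
    then show ?thesis unfolding l r by (simp add: algebra_simps)
  qed
qed

lemma potential_step_last: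
  assumes "d > 0" "a \<ge> 0" "b \<ge> 0" "2 * d < a + b"
  shows "potential d a b + potential_deriv d a b * x \<le> potential d (max (a - x) 0) (max (b + x) 0)"
proof (cases "x \<ge> 0")
  case True then show ?thesis using potential_step_last_right assms by blast
next
  case False
  then show ?thesis using potential_step_last_right[of d b a "-x"] assms
    by (simp add: potential_swap[of d b a] potential_swap[of d "max (b + x) 0"])
qed

text \<open>In this regime \<open>potential_step\<close> is an equality while the range does not
  grow, and is off by at most twice the squared growth otherwise.\<close>

lemma potential_step_ge_small_right:
  assumes d: "d > 0" and ab: "a \<ge> 0" "b \<ge> 0" and D: "a + b \<le> 2 * d" and x: "x \<ge> 0"
  shows "potential d a b + potential_deriv d a b * x + 2 * x\<^sup>2 - 2 * (max (a - x) 0 + max (b + x) 0 - (a + b))\<^sup>2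
     \<le> potential d (max (a - x) 0) (max (b + x) 0)" (is "?l \<le> ?r")
proof (cases "x \<le> a")
  case True
  with D ab x show ?thesis by (simp add: potential_def potential_deriv_def power2_eq_square algebra_simps)
next
  case False
  define e where "e = x - a"
  then have e: "e > 0" "x = a + e" using False by auto
  have ns: "max (a - x) 0 = 0" "max (b + x) 0 = a + b + e" using e ab by auto
  show ?thesis
  proof (cases "a + b + e \<le> 2 * d")
    case True
    have "?r - ?l = e\<^sup>2" using True e
      unfolding ns by (simp add: potential_def potential_deriv_def power2_eq_square algebra_simps)
    then show ?thesis using zero_le_power2[of e] by linarith
  next
    case False
    have r: "?r = 4 * d * (a + b + e) + 2 * d\<^sup>2" using False d unfolding ns
      by (simp add: potential_def)
    have "4 * d * (a + b + e) + 2 * d\<^sup>2 - ?l = e\<^sup>2 - (a + b + e - 2 * d)\<^sup>2" unfolding ns using D e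
      by (simp add: potential_def potential_deriv_def power2_eq_square algebra_simps)
    moreover have "(a + b + e - 2 * d)\<^sup>2 \<le> e\<^sup>2" using D False by (intro power_mono) auto
    ultimately show ?thesis unfolding r by linarith
  qed
qed

lemma potential_step_ge_small:
  assumes "d > 0" "a \<ge> 0" "b \<ge> 0" "a + b \<le> 2 * d"
  shows "potential d a b + potential_deriv d a b * x + 2 * x\<^sup>2 - 2 * (max (a - x) 0 + max (b + x) 0 - (a + b))\<^sup>2
     \<le> potential d (max (a - x) 0) (max (b + x) 0)"
proof (cases "x \<ge> 0")
  case True then show ?thesis using potential_step_ge_small_right assms by blast
next
  case False
  then show ?thesis using potential_step_ge_small_right[of d b a "-x"] assms
    by (simp add: potential_swap[of d b a] potential_swap[of d "max (b + x) 0"] add.commute)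
qed

text \<open>\<open>a - x \<le> d\<close> keeps the path within \<open>d\<close> of its maximum, so
  the quadratic piece is never left and only an overshoot costs anything.\<close>

lemma potential_step_ge_near:
  assumes d: "d > 0" and ab: "a \<ge> 0" "b \<ge> 0" and D: "2 * d < a + b"
    and x: "a < d" "a - x \<le> d"
  shows "potential d a b + potential_deriv d a b * x + 2 * x\<^sup>2 - 2 * (max (a - x) 0 + max (b + x) 0 - (a + b))\<^sup>2
     \<le> potential d (max (a - x) 0) (max (b + x) 0)" (is "?l \<le> ?r")
proof (cases "x \<le> a")
  case True
  then have "max (a - x) 0 = a - x" "max (b + x) 0 = b + x" "max 0 (d - (b + x)) = 0"
      "max 0 (d - a) = d - a" "max 0 (d - b) = 0" "max 0 (d - (a - x)) = d - (a - x)"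
    using ab x D by auto
  then show ?thesis using D by (simp add: potential_def potential_deriv_def) (simp add: power2_eq_square algebra_simps)
next
  case False
  define e where "e = x - a"
  then have e: "e > 0" "x = a + e" using False by auto
  have ns: "max (a - x) 0 = 0" "max (b + x) 0 = a + b + e" "max 0 (d - a) = d - a" "max 0 (d - b) = 0"
    using e ab D x by auto
  have r: "?r = 4 * d * (a + b + e) + 2 * d\<^sup>2" using D e d unfolding ns
    by (simp add: potential_def)
  have "4 * d * (a + b + e) + 2 * d\<^sup>2 - ?l = 0" unfolding ns using D e
    by (simp add: potential_def potential_deriv_def ns(3,4)) (simp add: power2_eq_square algebra_simps)
  then show ?thesis unfolding r by linarith
qed

text \<open>For a range above \<open>2 * d\<close> the hypothesis says that the step starts within
  \<open>d\<close> of an extremum and does not move farther than \<open>d\<close> away from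
  it.\<close>

lemma potential_step_ge:
  assumes "d > 0" "a \<ge> 0" "b \<ge> 0"
    and "a + b \<le> 2 * d \<or> (a < d \<and> a - x \<le> d) \<or> (b < d \<and> b + x \<le> d)"
  shows "potential d a b + potential_deriv d a b * x + 2 * x\<^sup>2 - 2 * (max (a - x) 0 + max (b + x) 0 - (a + b))\<^sup>2
     \<le> potential d (max (a - x) 0) (max (b + x) 0)"
  using assms potential_step_ge_small[of d a b x] potential_step_ge_near[of d a b x] potential_step_ge_near[of d b a "-x"]
  by (cases "a + b \<le> 2 * d")
    (auto simp: potential_swap[of d b a] potential_swap[of d "max (b + x) 0"] add.commute)

subsection \<open>Discretised paths\<close>

primrec gmax :: "(nat \<Rightarrow> real) \<Rightarrow> nat \<Rightarrow> real" where
  "gmax x 0 = x 0"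
| "gmax x (Suc k) = max (gmax x k) (x (Suc k))"

lemma gmax_ge: "j \<le> k \<Longrightarrow> x j \<le> gmax x k"
  by (induction k) (auto simp: le_Suc_eq max_def intro: order.trans)

lemma gmax_attained: "\<exists>j\<le>k. gmax x k = x j"
proof (induction k)
  case (Suc k)
  then show ?case by (auto simp: max_def intro: le_SucI)
qed auto

lemma gmax_mono: "j \<le> k \<Longrightarrow> gmax x j \<le> gmax x k"
  by (induction k) (auto simp: le_Suc_eq max_def intro: order.trans)

definition upper_gap :: "(nat \<Rightarrow> real) \<Rightarrow> nat \<Rightarrow> real" where
  "upper_gap x k = gmax x k - x k"

text \<open>Reflection lets every fact about maxima serve for minima.\<close>

definition lower_gap :: "(nat \<Rightarrow> real) \<Rightarrow> nat \<Rightarrow> real" where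
  "lower_gap x = upper_gap (\<lambda>i. - x i)"

definition grange :: "(nat \<Rightarrow> real) \<Rightarrow> nat \<Rightarrow> real" where
  "grange x k = upper_gap x k + lower_gap x k"

lemma gap_0 [simp]: "upper_gap x 0 = 0" "lower_gap x 0 = 0"
  by (auto simp: upper_gap_def lower_gap_def)

lemma gap_nonneg [simp]: "upper_gap x k \<ge> 0" "lower_gap x k \<ge> 0"
  using gmax_ge[of k k x] gmax_ge[of k k "\<lambda>i. - x i"] by (auto simp: upper_gap_def lower_gap_def)

text \<open>The gaps obey a recursion driven by the increments alone, with the very transition of
  the step lemmas, so those can be iterated along any path.\<close>

lemma gap_Suc:
  "upper_gap x (Suc k) = max (upper_gap x k - (x (Suc k) - x k)) 0"
  "lower_gap x (Suc k) = max (lower_gap x k + (x (Suc k) - x k)) 0"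
  by (auto simp: upper_gap_def lower_gap_def max_def)

lemma grange_eq: "grange x k = gmax x k + gmax (\<lambda>i. - x i) k"
  by (simp add: grange_def upper_gap_def lower_gap_def)

lemma grange_nonneg: "grange x k \<ge> 0"
  by (simp add: grange_def)

lemma grange_mono: "j \<le> k \<Longrightarrow> grange x j \<le> grange x k"
  unfolding grange_eq by (intro add_mono gmax_mono)

lemma grange_ge: "i \<le> k \<Longrightarrow> j \<le> k \<Longrightarrow> \<bar>x i - x j\<bar> \<le> grange x k"
  using gmax_ge[of i k x] gmax_ge[of j k x] gmax_ge[of i k "\<lambda>i. - x i"] gmax_ge[of j k "\<lambda>i. - x i"]
  by (simp add: grange_eq)

lemma grange_Suc_le: "grange x (Suc k) - grange x k \<le> \<bar>x (Suc k) - x k\<bar>"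
  using gap_nonneg(1)[of x k] gap_nonneg(2)[of x k]
  by (auto simp: grange_def gap_Suc max_def; linarith)

lemma potential_path_le:
  assumes "d > 0"
  shows "potential d (upper_gap x k) (lower_gap x k) \<le> 6 * d\<^sup>2 +
     (\<Sum>i<k. potential_deriv d (upper_gap x i) (lower_gap x i) * (x (Suc i) - x i) + 2 * (x (Suc i) - x i)\<^sup>2)"
proof (induction k)
  case 0
  show ?case using assms by (simp add: potential_def)
next
  case (Suc k)
  then show ?case
    using potential_step[OF assms, of "upper_gap x k" "lower_gap x k" "x (Suc k) - x k"] by (simp add: gap_Suc)
qed

text \<open>Half the accumulated loss of the lower bound: the squared growth of the range at each
  step, and the squared last step, for which \<open>potential_step_last\<close> gives up the
  quadratic term. For \<open>k = 0\<close> truncated subtraction makes the last term vanish.\<close>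

definition grid_error :: "(nat \<Rightarrow> real) \<Rightarrow> nat \<Rightarrow> real" where
  "grid_error x k = (\<Sum>i<k. (grange x (Suc i) - grange x i)\<^sup>2) + (x k - x (k - 1))\<^sup>2"

lemma potential_path_ge_aux:
  assumes "d > 0"
    and "\<And>i. i < k \<Longrightarrow> upper_gap x i + lower_gap x i \<le> 2 * d
      \<or> (upper_gap x i < d \<and> upper_gap x i - (x (Suc i) - x i) \<le> d)
      \<or> (lower_gap x i < d \<and> lower_gap x i + (x (Suc i) - x i) \<le> d)"
  shows "6 * d\<^sup>2 +
     (\<Sum>i<k. potential_deriv d (upper_gap x i) (lower_gap x i) * (x (Suc i) - x i) + 2 * (x (Suc i) - x i)\<^sup>2)
     - 2 * (\<Sum>i<k. (grange x (Suc i) - grange x i)\<^sup>2)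
     \<le> potential d (upper_gap x k) (lower_gap x k)"
  using assms(2)
proof (induction k)
  case 0
  show ?case using assms by (simp add: potential_def)
next
  case (Suc k)
  then have IH: "6 * d\<^sup>2 +
     (\<Sum>i<k. potential_deriv d (upper_gap x i) (lower_gap x i) * (x (Suc i) - x i) + 2 * (x (Suc i) - x i)\<^sup>2)
     - 2 * (\<Sum>i<k. (grange x (Suc i) - grange x i)\<^sup>2)
     \<le> potential d (upper_gap x k) (lower_gap x k)" by simp
  have "potential d (upper_gap x k) (lower_gap x k) + potential_deriv d (upper_gap x k) (lower_gap x k) * (x (Suc k) - x k) +
        2 * (x (Suc k) - x k)\<^sup>2 - 2 * (grange x (Suc k) - grange x k)\<^sup>2
      \<le> potential d (upper_gap x (Suc k)) (lower_gap x (Suc k))"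
    unfolding grange_def gap_Suc
    by (rule potential_step_ge[OF assms(1) _ _ Suc.prems]) auto
  with IH show ?case by simp
qed

text \<open>Only the last step before stopping may jump across the stopping region.\<close>

lemma potential_path_ge:
  assumes "d > 0"
    and "\<And>i. Suc i < k \<Longrightarrow> upper_gap x i + lower_gap x i \<le> 2 * d
      \<or> (upper_gap x i < d \<and> upper_gap x i - (x (Suc i) - x i) \<le> d)
      \<or> (lower_gap x i < d \<and> lower_gap x i + (x (Suc i) - x i) \<le> d)"
  shows "6 * d\<^sup>2 +
     (\<Sum>i<k. potential_deriv d (upper_gap x i) (lower_gap x i) * (x (Suc i) - x i) + 2 * (x (Suc i) - x i)\<^sup>2)
     - 2 * grid_error x k \<le> potential d (upper_gap x k) (lower_gap x k)"
proof (cases k)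
  case 0
  then show ?thesis using assms by (simp add: potential_def grid_error_def)
next
  case (Suc j)
  have *: "6 * d\<^sup>2 +
     (\<Sum>i<j. potential_deriv d (upper_gap x i) (lower_gap x i) * (x (Suc i) - x i) + 2 * (x (Suc i) - x i)\<^sup>2)
     - 2 * (\<Sum>i<j. (grange x (Suc i) - grange x i)\<^sup>2)
     \<le> potential d (upper_gap x j) (lower_gap x j)"
    using Suc by (intro potential_path_ge_aux assms) auto
  have "potential d (upper_gap x j) (lower_gap x j) + potential_deriv d (upper_gap x j) (lower_gap x j) * (x (Suc j) - x j) +
        2 * (x (Suc j) - x j)\<^sup>2 - 2 * (grange x (Suc j) - grange x j)\<^sup>2 - 2 * (x (Suc j) - x j)\<^sup>2
      \<le> potential d (upper_gap x (Suc j)) (lower_gap x (Suc j))"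
  proof (cases "upper_gap x j + lower_gap x j \<le> 2 * d")
    case True
    then show ?thesis
      using potential_step_ge[OF assms(1), of "upper_gap x j" "lower_gap x j" "x (Suc j) - x j"]
        zero_le_power2[of "x (Suc j) - x j"]
      unfolding grange_def gap_Suc by (smt (verit) gap_nonneg)
  next
    case False
    then show ?thesis
      using potential_step_last[OF assms(1), of "upper_gap x j" "lower_gap x j" "x (Suc j) - x j"]
        zero_le_power2[of "grange x (Suc j) - grange x j"]
      unfolding gap_Suc by (smt (verit) gap_nonneg)
  qed
  with * show ?thesis by (simp add: Suc grid_error_def)
qed

text \<open>Doob's maximal inequality in pathwise form: the sum is a martingale transform, so in
  expectation only the constant 4 remains.\<close>

lemma gmax_square_le:
  assumes "x 0 = 0"
  shows "(gmax x k)\<^sup>2 \<le> 4 * (x k)\<^sup>2 - 4 * (\<Sum>i<k. gmax x i * (x (Suc i) - x i))"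
proof -
  \<comment> \<open>Left side minus right side changes only when a new maximum is reached, and then
    drops by the square of the growth of \<open>gmax\<close>.\<close>
  have "(gmax x k)\<^sup>2 - 2 * gmax x k * x k \<le> - 2 * (\<Sum>i<k. gmax x i * (x (Suc i) - x i))"
  proof (induction k)
    case (Suc k)
    have "0 \<le> (gmax x k - x (Suc k))\<^sup>2" by simp
    with Suc show ?case
      by (simp add: max_def power2_eq_square algebra_simps)
  qed (use assms in auto)
  moreover have "0 \<le> (gmax x k - 2 * x k)\<^sup>2" by simp
  then have "(gmax x k)\<^sup>2 \<le> 2 * ((gmax x k)\<^sup>2 - 2 * gmax x k * x k) + 4 * (x k)\<^sup>2"
    by (simp add: power2_eq_square algebra_simps)
  ultimately show ?thesis by (smt (verit))
qed

section \<open>Running maxima of continuous paths and their grid approximations\<close>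

definition rmax :: "(real \<Rightarrow> real) \<Rightarrow> real \<Rightarrow> real" where
  "rmax f t = (SUP s\<in>{0..t}. f s)"

definition rrange :: "(real \<Rightarrow> real) \<Rightarrow> real \<Rightarrow> real" where
  "rrange f t = rmax f t + rmax (\<lambda>s. - f s) t"

lemma running_max_eq: "running_max B t \<omega> = rmax (\<lambda>s. B s \<omega>) t"
  by (simp add: running_max_def rmax_def)

lemma running_min_eq: "running_min B t \<omega> = - rmax (\<lambda>s. - B s \<omega>) t"
  by (simp add: running_min_def rmax_def Inf_real_def image_image)

lemma running_range_eq: "running_range B t \<omega> = rrange (\<lambda>s. B s \<omega>) t"
  by (simp add: running_range_def running_max_eq running_min_eq rrange_def)

lemma bdd_above_path:
  fixes f :: "real \<Rightarrow> real"
  assumes "continuous_on {0..} f" shows "bdd_above (f ` {0..t})"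
  by (intro bounded_imp_bdd_above compact_imp_bounded compact_continuous_image
      continuous_on_subset[OF assms]) auto

lemma rmax_ge:
  assumes "continuous_on {0..} f" "0 \<le> s" "s \<le> t" shows "f s \<le> rmax f t"
  unfolding rmax_def using assms bdd_above_path by (intro cSUP_upper) auto

lemma rmax_le:
  assumes "0 \<le> t" "\<And>s. 0 \<le> s \<Longrightarrow> s \<le> t \<Longrightarrow> f s \<le> c" shows "rmax f t \<le> c"
  unfolding rmax_def using assms by (intro cSUP_least) auto

lemma rmax_attained:
  assumes "continuous_on {0..} f" "0 \<le> t" obtains s where "0 \<le> s" "s \<le> t" "rmax f t = f s"
proof -
  obtain s where "s \<in> {0..t}" "\<forall>y\<in>{0..t}. f y \<le> f s"
    using continuous_attains_sup[of "{0..t}" f] continuous_on_subset[OF assms(1), of "{0..t}"] assms(2)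
    by auto
  then show ?thesis using rmax_le[of t f "f s"] rmax_ge[OF assms(1), of s t] assms that[of s] by force
qed

lemma rmax_mono:
  assumes "continuous_on {0..} f" "0 \<le> s" "s \<le> t" shows "rmax f s \<le> rmax f t"
  using assms by (intro rmax_le rmax_ge) auto

lemma continuous_on_rmax:
  assumes f: "continuous_on {0..} f" shows "continuous_on {0..} (rmax f)"
  unfolding continuous_on_iff
proof (intro ballI allI impI)
  fix t e :: real assume t: "t \<in> {0..}" and e: "e > 0"
  have "e / 3 > 0" using e by simp
  then obtain r where r: "r > 0" "\<And>s. s \<in> {0..} \<Longrightarrow> dist s t < r \<Longrightarrow> dist (f s) (f t) < e / 3"
    using f t unfolding continuous_on_iff by blast
  have "dist (rmax f t') (rmax f t) < e" if t': "t' \<in> {0..}" "dist t' t < r" for t'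
  proof -
    have "rmax f t' \<le> rmax f t + e / 3"
    proof (rule rmax_le)
      fix s assume s: "0 \<le> s" "s \<le> t'"
      show "f s \<le> rmax f t + e / 3"
      proof (cases "s \<le> t")
        case True then show ?thesis using rmax_ge[OF f, of s t] s e by simp
      next
        case False
        then have "dist s t < r" using s t'(2) by (simp add: dist_real_def)
        then have "\<bar>f s - f t\<bar> < e / 3" using r(2)[of s] s by (simp add: dist_real_def)
        then have "f s \<le> f t + e / 3" by linarith
        then show ?thesis using rmax_ge[OF f, of t t] t by simp
      qed
    qed (use t' in auto)
    moreover have "rmax f t \<le> rmax f t' + 2 * (e / 3)"
    proof (rule rmax_le)
      fix s assume s: "0 \<le> s" "s \<le> t"
      show "f s \<le> rmax f t' + 2 * (e / 3)"
      proof (cases "s \<le> t'")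
        case True then show ?thesis using rmax_ge[OF f, of s t'] s e by simp
      next
        case False
        then have "dist s t < r" using s t'(2) by (simp add: dist_real_def)
        then have "\<bar>f s - f t\<bar> < e / 3" using r(2)[of s] s by (simp add: dist_real_def)
        then have "f s \<le> f t + e / 3" by linarith
        moreover have "\<bar>f t' - f t\<bar> < e / 3" using r(2)[of t'] t' by (simp add: dist_real_def)
        then have "f t \<le> f t' + e / 3" by linarith
        ultimately show ?thesis using rmax_ge[OF f, of t' t'] t' by simp
      qed
    qed (use t in auto)
    ultimately show ?thesis using e by (simp add: dist_real_def)
  qed
  with r show "\<exists>d>0. \<forall>x'\<in>{0..}. dist x' t < d \<longrightarrow> dist (rmax f x') (rmax f t) < e" by blast
qed

lemma gmax_le_rmax:
  assumes "continuous_on {0..} f" "h \<ge> 0" "real k * h \<le> t"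
  shows "gmax (\<lambda>j. f (real j * h)) k \<le> rmax f t"
proof -
  obtain j where "j \<le> k" and j: "gmax (\<lambda>j. f (real j * h)) k = f (real j * h)"
    using gmax_attained[of k "\<lambda>j. f (real j * h)"] by blast
  have "real j * h \<le> real k * h" using \<open>j \<le> k\<close> assms by (intro mult_right_mono) auto
  then show ?thesis unfolding j using assms by (intro rmax_ge) auto
qed

lemma continuous_on_uminus_path:
  "continuous_on S f \<Longrightarrow> continuous_on S (\<lambda>s. - f s)" for f :: "real \<Rightarrow> real"
  by (intro continuous_intros)

lemma grange_le_rrange:
  assumes "continuous_on {0..} f" "h \<ge> 0" "real k * h \<le> t"
  shows "grange (\<lambda>j. f (real j * h)) k \<le> rrange f t"
  unfolding grange_eq rrange_def
  using assms by (intro add_mono gmax_le_rmax continuous_on_uminus_path)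

lemma rrange_mono:
  assumes "continuous_on {0..} f" "0 \<le> s" "s \<le> t" shows "rrange f s \<le> rrange f t"
  unfolding rrange_def using assms by (intro add_mono rmax_mono continuous_on_uminus_path)

lemma rrange_ge:
  assumes "continuous_on {0..} f" "0 \<le> s" "s \<le> t" "0 \<le> r" "r \<le> t" shows "\<bar>f s - f r\<bar> \<le> rrange f t"
  using assms rmax_ge[OF assms(1), of s t] rmax_ge[OF assms(1), of r t]
    rmax_ge[OF continuous_on_uminus_path[OF assms(1)], of s t]
    rmax_ge[OF continuous_on_uminus_path[OF assms(1)], of r t]
  by (auto simp: rrange_def)

lemma rrange_nonneg:
  assumes "continuous_on {0..} f" "0 \<le> t" shows "0 \<le> rrange f t"
  using rrange_ge[OF assms(1), of 0 t 0] assms(2) by auto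

lemma LIMSEQ_path:
  fixes f :: "real \<Rightarrow> real"
  assumes "continuous_on {0..} f" "t \<ge> 0" "u \<longlonglongrightarrow> t" "\<And>n. u n \<ge> 0"
  shows "(\<lambda>n. f (u n)) \<longlonglongrightarrow> f t"
  by (rule continuous_on_tendsto_compose[OF assms(1,3)]) (use assms in auto)

lemma floor_grid_le:
  assumes "0 \<le> s" "0 < h" shows "real (nat \<lfloor>s / h\<rfloor>) * h \<le> s"
proof -
  have "real (nat \<lfloor>s / h\<rfloor>) \<le> s / h" using assms by simp
  then show ?thesis using pos_le_divide_eq[OF assms(2)] by blast
qed

lemma LIMSEQ_floor_grid:
  assumes s: "0 \<le> s" and h: "\<And>n. h n > 0" "h \<longlonglongrightarrow> 0"
  shows "(\<lambda>n. real (nat \<lfloor>s / h n\<rfloor>) * h n) \<longlonglongrightarrow> s"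
proof (rule tendsto_sandwich[of "\<lambda>n. s - h n" _ _ "\<lambda>n. s"])
  have "s - h n \<le> real (nat \<lfloor>s / h n\<rfloor>) * h n" for n
  proof -
    have "real (nat \<lfloor>s / h n\<rfloor>) = of_int \<lfloor>s / h n\<rfloor>" using s h(1)[of n] by simp
    then have "s / h n - 1 \<le> real (nat \<lfloor>s / h n\<rfloor>)" by linarith
    then have "(s / h n - 1) * h n \<le> real (nat \<lfloor>s / h n\<rfloor>) * h n"
      using h(1)[of n] by (intro mult_right_mono) auto
    then show ?thesis using h(1)[of n] by (simp add: left_diff_distrib)
  qed
  then show "\<forall>\<^sub>F n in sequentially. s - h n \<le> real (nat \<lfloor>s / h n\<rfloor>) * h n" by simp
  show "\<forall>\<^sub>F n in sequentially. real (nat \<lfloor>s / h n\<rfloor>) * h n \<le> s"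
    using floor_grid_le[OF s h(1)] by simp
  show "(\<lambda>n. s - h n) \<longlonglongrightarrow> s" using tendsto_diff[OF tendsto_const h(2)] by simp
qed auto

text \<open>A squeeze between the path at a grid point just below a maximiser and the continuous
  running maximum at the last grid time.\<close>

lemma LIMSEQ_gmax:
  assumes f: "continuous_on {0..} f" and h: "\<And>n. h n > 0" "h \<longlonglongrightarrow> 0"
    and K: "(\<lambda>n. real (K n) * h n) \<longlonglongrightarrow> t"
  shows "(\<lambda>n. gmax (\<lambda>j. f (real j * h n)) (K n)) \<longlonglongrightarrow> rmax f t"
proof -
  have h0: "0 \<le> h n" for n using h(1)[of n] by simp
  have t: "t \<ge> 0" by (rule LIMSEQ_le_const[OF K]) (simp add: h(1) less_imp_le)
  obtain s where s: "0 \<le> s" "s \<le> t" "rmax f t = f s" using rmax_attained[OF f t] .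
  \<comment> \<open>The minimum keeps the index admissible when the grid ends before the maximiser
    \<open>s\<close>.\<close>
  define j where "j n = min (K n) (nat \<lfloor>s / h n\<rfloor>)" for n
  note fl = LIMSEQ_floor_grid[OF s(1) h]
  have "real (j n) * h n = min (real (K n) * h n) (real (nat \<lfloor>s / h n\<rfloor>) * h n)" for n
    using h(1)[of n] unfolding j_def by (auto simp: min_def)
  moreover have "(\<lambda>n. min (real (K n) * h n) (real (nat \<lfloor>s / h n\<rfloor>) * h n)) \<longlonglongrightarrow> min t s"
    by (intro tendsto_min K fl)
  ultimately have "(\<lambda>n. real (j n) * h n) \<longlonglongrightarrow> s" using s by (simp add: min_absorb2)
  then have 1: "(\<lambda>n. f (real (j n) * h n)) \<longlonglongrightarrow> rmax f t"
    unfolding s(3) using h0 s by (intro LIMSEQ_path[OF f]) auto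
  have 2: "(\<lambda>n. rmax f (real (K n) * h n)) \<longlonglongrightarrow> rmax f t"
    using h0 t by (intro LIMSEQ_path[OF continuous_on_rmax[OF f]] K) auto
  show ?thesis
  proof (rule tendsto_sandwich[OF _ _ 1 2])
    show "\<forall>\<^sub>F n in sequentially. f (real (j n) * h n) \<le> gmax (\<lambda>j. f (real j * h n)) (K n)"
      by (intro always_eventually allI gmax_ge) (auto simp: j_def)
    show "\<forall>\<^sub>F n in sequentially. gmax (\<lambda>j. f (real j * h n)) (K n) \<le> rmax f (real (K n) * h n)"
      using h0 by (intro always_eventually allI gmax_le_rmax f) auto
  qed
qed

lemma LIMSEQ_grange:
  assumes f: "continuous_on {0..} f" and h: "\<And>n. h n > 0" "h \<longlonglongrightarrow> 0"
    and K: "(\<lambda>n. real (K n) * h n) \<longlonglongrightarrow> t"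
  shows "(\<lambda>n. grange (\<lambda>j. f (real j * h n)) (K n)) \<longlonglongrightarrow> rrange f t"
  unfolding grange_eq rrange_def
  by (intro tendsto_add LIMSEQ_gmax continuous_on_uminus_path assms)

lemma LIMSEQ_gap:
  assumes f: "continuous_on {0..} f" and h: "\<And>n. h n > 0" "h \<longlonglongrightarrow> 0"
    and K: "(\<lambda>n. real (K n) * h n) \<longlonglongrightarrow> t"
  shows "(\<lambda>n. upper_gap (\<lambda>j. f (real j * h n)) (K n)) \<longlonglongrightarrow> rmax f t - f t"
    and "(\<lambda>n. lower_gap (\<lambda>j. f (real j * h n)) (K n)) \<longlonglongrightarrow> rmax (\<lambda>s. - f s) t + f t"
proof -
  have h0: "0 \<le> h n" for n using h(1)[of n] by simp
  have t: "t \<ge> 0" by (rule LIMSEQ_le_const[OF K]) (simp add: h(1) less_imp_le)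
  have "(\<lambda>n. f (real (K n) * h n)) \<longlonglongrightarrow> f t"
    using h0 by (intro LIMSEQ_path[OF f t K]) auto
  moreover note LIMSEQ_gmax[OF f h K] LIMSEQ_gmax[OF continuous_on_uminus_path[OF f] h K]
  ultimately show "(\<lambda>n. upper_gap (\<lambda>j. f (real j * h n)) (K n)) \<longlonglongrightarrow> rmax f t - f t"
    "(\<lambda>n. lower_gap (\<lambda>j. f (real j * h n)) (K n)) \<longlonglongrightarrow> rmax (\<lambda>s. - f s) t + f t"
    unfolding upper_gap_def lower_gap_def by (auto intro!: tendsto_intros)
qed

section \<open>Bound and limit of the discretisation error\<close>

lemma sum_range_increments: "(\<Sum>i<k. grange x (Suc i) - grange x i) = grange x k"
  by (induction k) (auto simp: grange_def)

text \<open>Squares of nonnegative numbers with sum R add up to at most the square of R; the last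
  step contributes at most one more such square. The bound does not depend on the mesh, so it serves
  for dominated convergence.\<close>

lemma grid_error_bound:
  assumes f: "continuous_on {0..} f" and h: "h > 0" and K: "real k * h \<le> t"
  shows "0 \<le> grid_error (\<lambda>j. f (real j * h)) k"
    and "grid_error (\<lambda>j. f (real j * h)) k \<le> 2 * (rrange f t)\<^sup>2"
proof -
  let ?x = "\<lambda>j. f (real j * h)"
  show "0 \<le> grid_error ?x k" by (auto simp: grid_error_def intro!: add_nonneg_nonneg sum_nonneg)
  have r: "grange ?x k \<le> rrange f t" using assms by (intro grange_le_rrange) auto
  have "(\<Sum>i<k. (grange ?x (Suc i) - grange ?x i)\<^sup>2)
      \<le> (\<Sum>i<k. (grange ?x (Suc i) - grange ?x i) * grange ?x k)"
  proof (rule sum_mono)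
    fix i assume "i \<in> {..<k}"
    then have "grange ?x (Suc i) - grange ?x i \<le> grange ?x k"
      using grange_mono[of "Suc i" k ?x] grange_nonneg[of ?x i] by auto
    then show "(grange ?x (Suc i) - grange ?x i)\<^sup>2 \<le> (grange ?x (Suc i) - grange ?x i) * grange ?x k"
      using grange_mono[of i "Suc i" ?x] unfolding power2_eq_square by (intro mult_left_mono) auto
  qed
  also have "\<dots> = (grange ?x k)\<^sup>2"
    by (simp add: sum_distrib_right[symmetric] sum_range_increments power2_eq_square)
  also have "\<dots> \<le> (rrange f t)\<^sup>2" using r grange_nonneg by (intro power_mono)
  finally have 1: "(\<Sum>i<k. (grange ?x (Suc i) - grange ?x i)\<^sup>2) \<le> (rrange f t)\<^sup>2" .
  have "\<bar>?x k - ?x (k - 1)\<bar> \<le> rrange f t" using grange_ge[of k k "k-1" ?x] r by simp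
  then have "\<bar>?x k - ?x (k - 1)\<bar>\<^sup>2 \<le> (rrange f t)\<^sup>2" by (intro power_mono) auto
  with 1 show "grid_error ?x k \<le> 2 * (rrange f t)\<^sup>2" by (simp add: grid_error_def)
qed

text \<open>By uniform continuity on \<open>{0..t}\<close> all increments become small, while the
  growths of the range sum to at most the range.\<close>

lemma LIMSEQ_grid_error:
  assumes f: "continuous_on {0..} f" and h: "\<And>n. h n > 0" "h \<longlonglongrightarrow> 0"
    and K: "\<And>n. real (K n) * h n \<le> t"
  shows "(\<lambda>n. grid_error (\<lambda>j. f (real j * h n)) (K n)) \<longlonglongrightarrow> 0"
proof (rule LIMSEQ_I)
  fix e :: real assume e: "e > 0"
  have t: "t \<ge> 0" using K[of 0] h(1)[of 0]
    by (metis less_imp_le mult_nonneg_nonneg of_nat_0_le_iff order.trans)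
  \<comment> \<open>The added 1 pays for the last step, whose square is at most
    \<open>c\<^sup>2 \<le> c\<close>.\<close>
  define R where "R = rrange f t + 1"
  have R: "R > 0" using rrange_nonneg[OF f t] by (simp add: R_def)
  define c where "c = min 1 (e / (2 * R))"
  have c: "c > 0" "c \<le> 1" "c * R \<le> e / 2" using e R
    by (auto simp: c_def min_def field_simps)
  have "uniformly_continuous_on {0..t} f"
    by (intro compact_uniformly_continuous continuous_on_subset[OF f]) auto
  then obtain r where r: "r > 0" "\<And>s s'. s \<in> {0..t} \<Longrightarrow> s' \<in> {0..t} \<Longrightarrow> dist s' s < r \<Longrightarrow> dist (f s') (f s) < c"
    using c(1) unfolding uniformly_continuous_on_def by meson
  obtain N where N: "\<And>n. n \<ge> N \<Longrightarrow> h n < r"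
    using LIMSEQ_D[OF h(2) r(1)] h(1) by (auto simp: abs_of_pos)
  have "grid_error (\<lambda>j. f (real j * h n)) (K n) < e" if "n \<ge> N" for n
  proof -
    let ?x = "\<lambda>j. f (real j * h n)"
    have small: "\<bar>?x (Suc i) - ?x i\<bar> \<le> c" if "i < K n" for i
    proof -
      have "real (Suc i) * h n \<le> real (K n) * h n" using that h(1)[of n]
        by (intro mult_right_mono) auto
      then have 1: "real (Suc i) * h n \<le> t" using K[of n] by linarith
      have 2: "real (Suc i) * h n = real i * h n + h n" by (simp add: algebra_simps)
      have 3: "0 \<le> real i * h n" using h(1)[of n] by simp
      show ?thesis using r(2)[of "real i * h n" "real (Suc i) * h n"] N[OF \<open>n \<ge> N\<close>] h(1)[of n] 1 3
        unfolding 2 dist_real_def by auto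
    qed
    have rr: "grange ?x (K n) \<le> rrange f t" using K[of n] h(1)[of n]
      by (intro grange_le_rrange f) auto
    have "(\<Sum>i<K n. (grange ?x (Suc i) - grange ?x i)\<^sup>2)
      \<le> (\<Sum>i<K n. (grange ?x (Suc i) - grange ?x i) * c)"
    proof (rule sum_mono)
      fix i assume "i \<in> {..<K n}"
      then have "grange ?x (Suc i) - grange ?x i \<le> c"
        using grange_Suc_le[of ?x i] small[of i] by simp
      then show "(grange ?x (Suc i) - grange ?x i)\<^sup>2 \<le> (grange ?x (Suc i) - grange ?x i) * c"
        using grange_mono[of i "Suc i" ?x] unfolding power2_eq_square by (intro mult_left_mono) auto
    qed
    also have "\<dots> = grange ?x (K n) * c"
      by (simp only: sum_distrib_right[symmetric] sum_range_increments)
    also have "\<dots> \<le> rrange f t * c" using c(1) rr by (intro mult_right_mono) auto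
    finally have 1: "(\<Sum>i<K n. (grange ?x (Suc i) - grange ?x i)\<^sup>2) \<le> rrange f t * c" .
    have "\<bar>?x (K n) - ?x (K n - 1)\<bar> \<le> c"
      using small[of "K n - 1"] c(1) by (cases "K n") auto
    then have "\<bar>?x (K n) - ?x (K n - 1)\<bar>\<^sup>2 \<le> c\<^sup>2" by (intro power_mono) auto
    also have "c\<^sup>2 \<le> c" using c by (simp add: power2_eq_square mult_left_le)
    finally have "grid_error ?x (K n) \<le> rrange f t * c + c" using 1 by (simp add: grid_error_def)
    also have "\<dots> = c * R" by (simp add: R_def algebra_simps)
    finally show ?thesis using c(3) e by linarith
  qed
  moreover have "0 \<le> grid_error (\<lambda>j. f (real j * h n)) (K n)" for n
    by (auto simp: grid_error_def intro!: add_nonneg_nonneg sum_nonneg)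
  ultimately show "\<exists>no. \<forall>n\<ge>no. norm (grid_error (\<lambda>j. f (real j * h n)) (K n) - 0) < e" by auto
qed

text \<open>A path that crosses the middle region within one grid step stops during that step, by the
  intermediate value theorem.\<close>

lemma near_extremum_before_stopping:
  assumes f: "continuous_on {0..} f" and h: "h > 0"
    and ns: "\<And>s. 0 \<le> s \<Longrightarrow> s \<le> real (Suc i) * h \<Longrightarrow>
      rmax f s - f s < d \<or> rmax (\<lambda>s. - f s) s + f s < d"
  defines "x \<equiv> (\<lambda>j. f (real j * h))"
  shows "upper_gap x i + lower_gap x i \<le> 2 * d
      \<or> (upper_gap x i < d \<and> upper_gap x i - (x (Suc i) - x i) \<le> d)
      \<or> (lower_gap x i < d \<and> lower_gap x i + (x (Suc i) - x i) \<le> d)"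
proof (cases "upper_gap x i + lower_gap x i \<le> 2 * d")
  case False
  let ?s = "real i * h" and ?s' = "real (Suc i) * h"
  have s: "0 \<le> ?s" "?s \<le> ?s'" using h by (auto simp: algebra_simps)
  have fm: "continuous_on {0..} (\<lambda>s. - f s)" using f by (rule continuous_on_uminus_path)
  have cont: "continuous_on {?s..?s'} f" using s(1) by (intro continuous_on_subset[OF f]) auto
  have G: "gmax x i \<le> rmax f s" "gmax (\<lambda>j. - x j) i \<le> rmax (\<lambda>s. - f s) s" if "?s \<le> s" for s
    unfolding x_def using that h by (intro gmax_le_rmax f fm; simp)+
  \<comment> \<open>Freezing the extrema at step \<open>i\<close> can only underestimate the true
    gaps at a later time.\<close>
  have bad: False if "?s \<le> s" "s \<le> ?s'" "d \<le> gmax x i - f s" "d \<le> gmax (\<lambda>j. - x j) i + f s" for s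
    using ns[of s] G[of s] that s by auto
  have ivt: "\<exists>s\<ge>?s. s \<le> ?s' \<and> f s = y" if "min (x i) (x (Suc i)) \<le> y" "y \<le> max (x i) (x (Suc i))" for y
  proof (cases "x i \<le> x (Suc i)")
    case True
    then show ?thesis using that IVT'[of f ?s y ?s'] s cont unfolding x_def by auto
  next
    case False
    then show ?thesis using that IVT2'[of f ?s' y ?s] s cont unfolding x_def by auto
  qed
  have lt: "upper_gap x i < d \<or> lower_gap x i < d"
    using bad[of ?s] s unfolding upper_gap_def lower_gap_def x_def by force
  show ?thesis
  proof (rule ccontr)
    assume "\<not> ?thesis"
    then have a: "upper_gap x i < d \<Longrightarrow> upper_gap x i - (x (Suc i) - x i) > d"
      and b: "lower_gap x i < d \<Longrightarrow> lower_gap x i + (x (Suc i) - x i) > d" by auto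
    from lt show False
    proof
      assume "upper_gap x i < d"
      with a obtain s where "?s \<le> s" "s \<le> ?s'" "f s = gmax x i - d"
        using ivt[of "gmax x i - d"] by (auto simp: upper_gap_def)
      then show False using bad[of s] False by (auto simp: upper_gap_def lower_gap_def)
    next
      assume "lower_gap x i < d"
      with b obtain s where "?s \<le> s" "s \<le> ?s'" "f s = d - gmax (\<lambda>j. - x j) i"
        using ivt[of "d - gmax (\<lambda>j. - x j) i"] by (auto simp: lower_gap_def upper_gap_def)
      then show False using bad[of s] False by (auto simp: upper_gap_def lower_gap_def)
    qed
  qed
qed auto

subsection \<open>Independence of past and increments\<close>

context brownian_motion begin

abbreviation F :: "real \<Rightarrow> 'a measure" where
  "F t \<equiv> natural_filtration M B (ennreal t)"

definition cylinders :: "ennreal \<Rightarrow> 'a set set" where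
  "cylinders t = {B s -` A \<inter> space M | s A. 0 \<le> s \<and> ennreal s \<le> t \<and> A \<in> sets borel}"

lemma cylinders_subset: "cylinders t \<subseteq> sets M"
  using measurable_B unfolding cylinders_def by (auto intro: measurable_sets)

lemma space_filtration [simp]: "space (natural_filtration M B t) = space M"
  unfolding natural_filtration_def by (rule space_measure_of) auto

lemma sets_filtration: "sets (natural_filtration M B t) = sigma_sets (space M) (cylinders t)"
  unfolding natural_filtration_def cylinders_def by (rule sets_measure_of) auto

lemma sets_filtration_subset: "sets (natural_filtration M B t) \<subseteq> sets M"
  unfolding sets_filtration using cylinders_subset by (rule sets.sigma_sets_subset)

lemma measurable_from_filtration:
  "f \<in> measurable (natural_filtration M B t) N \<Longrightarrow> f \<in> measurable M N"
  using sets_filtration_subset[of t] by (auto simp: measurable_def)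

lemma measurable_B_filtration:
  assumes "0 \<le> s" "ennreal s \<le> t" shows "B s \<in> borel_measurable (natural_filtration M B t)"
proof (rule measurableI)
  fix A :: "real set" assume "A \<in> sets borel"
  then show "B s -` A \<inter> space (natural_filtration M B t) \<in> sets (natural_filtration M B t)"
    unfolding sets_filtration using assms
    by (intro sigma_sets.Basic) (auto simp: cylinders_def)
qed auto

text \<open>Past values are partial sums of increments over a common finite set of times, so
  independence of finitely many increments suffices.\<close>

lemma indep_finite_past:
  assumes I: "finite I" "I \<subseteq> {0..t}" and t: "0 \<le> t" "t < u"
    and C: "C \<in> sets (PiM I (\<lambda>_. borel))" and A: "A \<in> sets borel"
  shows "prob (((\<lambda>\<omega>. \<lambda>s\<in>I. B s \<omega>) -` C \<inter> space M) \<inter> ((\<lambda>\<omega>. B u \<omega> - B t \<omega>) -` A \<inter> space M)) =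
    prob ((\<lambda>\<omega>. \<lambda>s\<in>I. B s \<omega>) -` C \<inter> space M) * prob ((\<lambda>\<omega>. B u \<omega> - B t \<omega>) -` A \<inter> space M)"
proof -
  \<comment> \<open>Adding 0 makes every \<open>B s\<close> a sum of increments, as
    \<open>B 0\<close> is 0; adding \<open>t\<close> makes the final increment exactly the one from
    \<open>t\<close> to \<open>u\<close>.\<close>
  define J where "J = insert 0 (insert t I)"
  have J: "finite J" "J \<subseteq> {0..t}" "0 \<in> J" "t \<in> J" using I t by (auto simp: J_def)
  define l where "l = sorted_list_of_set J"
  define n where "n = length l - 1"
  define p where "p i = (if i \<le> n then l ! i else u)" for i
  have l: "set l = J" "sorted_wrt (<) l"
    using J by (auto simp: l_def)
  then have "l \<noteq> []" using J by auto
  then have len: "length l = Suc n" by (simp add: n_def)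
  have lmem: "l ! i \<in> J" if "i \<le> n" for i using nth_mem[of i l] that len l by simp
  have lmono: "l ! i \<le> l ! j" if "i \<le> j" "j \<le> n" for i j
    using sorted_wrt_nth_less[OF l(2), of i j] that len by (cases "i = j") auto
  obtain i0 where i0: "i0 \<le> n" "l ! i0 = 0" using J(3) l(1) len by (auto simp: in_set_conv_nth less_Suc_eq_le)
  obtain it where it: "it \<le> n" "l ! it = t" using J(4) l(1) len by (auto simp: in_set_conv_nth less_Suc_eq_le)
  have l0: "l ! 0 = 0" using lmono[of 0 i0] i0 lmem[of 0] J(2) by force
  have ln: "l ! n = t" using lmono[of it n] it lmem[of n] J(2) by force
  define X where "X i \<omega> = B (p (Suc i)) \<omega> - B (p i) \<omega>" for i \<omega>
  have "indep_vars (\<lambda>_. borel) (\<lambda>i \<omega>. B (p (Suc i)) \<omega> - B (p i) \<omega>) {..<Suc n}"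
  proof (rule indep_increments)
    show "0 \<le> p 0" by (simp add: p_def l0)
    fix i assume "i < Suc n"
    then show "p i < p (Suc i)"
      using sorted_wrt_nth_less[OF l(2), of i "Suc i"] len ln t
      by (cases "i = n") (auto simp: p_def)
  qed
  then have "indep_vars (\<lambda>_. borel) X {..<Suc n}" by (simp add: X_def[abs_def])
  then have ind: "indep_var (PiM {..<n} (\<lambda>_. borel)) (\<lambda>\<omega>. restrict (\<lambda>i. X i \<omega>) {..<n})
      (PiM {n} (\<lambda>_. borel)) (\<lambda>\<omega>. restrict (\<lambda>i. X i \<omega>) {n})"
    by (rule indep_var_restrict) auto
  define idx where "idx s = (SOME i. i \<le> n \<and> l ! i = s)" for s
  have idx: "idx s \<le> n \<and> l ! idx s = s" if "s \<in> I" for s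
    unfolding idx_def by (rule someI_ex)
      (use that l(1) len in \<open>auto simp: J_def in_set_conv_nth less_Suc_eq_le\<close>)
  define S :: "(nat \<Rightarrow> real) \<Rightarrow> real \<Rightarrow> real" where "S y = (\<lambda>s\<in>I. \<Sum>i<idx s. y i)" for y
  have "S \<in> measurable (PiM {..<n} (\<lambda>_. borel)) (PiM I (\<lambda>_. borel))"
    unfolding S_def[abs_def]
  proof (rule measurable_restrict)
    fix s assume "s \<in> I"
    then show "(\<lambda>y. \<Sum>i<idx s. y i) \<in> borel_measurable (PiM {..<n} (\<lambda>_. borel :: real measure))"
      using idx[of s] by (intro borel_measurable_sum measurable_component_singleton) auto
  qed
  then have C': "S -` C \<inter> space (PiM {..<n} (\<lambda>_. borel)) \<in> sets (PiM {..<n} (\<lambda>_. borel))"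
    using C by (rule measurable_sets)
  have A': "(\<lambda>y. y n) -` A \<inter> space (PiM {n} (\<lambda>_. borel :: real measure)) \<in> sets (PiM {n} (\<lambda>_. borel))"
    by (rule measurable_sets[OF _ A]) (auto intro: measurable_component_singleton)
  have S: "S (restrict (\<lambda>i. X i \<omega>) {..<n}) = (\<lambda>s\<in>I. B s \<omega>)" if "\<omega> \<in> space M" for \<omega>
  proof (rule ext)
    fix s
    show "S (restrict (\<lambda>i. X i \<omega>) {..<n}) s = (\<lambda>s\<in>I. B s \<omega>) s"
    proof (cases "s \<in> I")
      case True
      have "(\<Sum>i<idx s. restrict (\<lambda>i. X i \<omega>) {..<n} i) = (\<Sum>i<idx s. B (p (Suc i)) \<omega> - B (p i) \<omega>)"
        using idx[OF True] by (intro sum.cong) (auto simp: X_def)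
      also have "\<dots> = B (p (idx s)) \<omega> - B (p 0) \<omega>"
        by (rule sum_lessThan_telescope)
      also have "\<dots> = B s \<omega>" using idx[OF True] B_0[OF that] by (simp add: p_def l0)
      finally show ?thesis using True by (simp add: S_def)
    qed (simp add: S_def)
  qed
  have 1: "(\<lambda>\<omega>. restrict (\<lambda>i. X i \<omega>) {..<n}) -` (S -` C \<inter> space (PiM {..<n} (\<lambda>_. borel))) \<inter> space M
      = (\<lambda>\<omega>. \<lambda>s\<in>I. B s \<omega>) -` C \<inter> space M"
    using S by (auto simp: space_PiM)
  have 2: "(\<lambda>\<omega>. restrict (\<lambda>i. X i \<omega>) {n}) -` ((\<lambda>y. y n) -` A \<inter> space (PiM {n} (\<lambda>_. borel :: real measure))) \<inter> space M
      = (\<lambda>\<omega>. B u \<omega> - B t \<omega>) -` A \<inter> space M"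
    by (auto simp: space_PiM X_def p_def ln)
  \<comment> \<open>\<open>potential_bound\<close> is merely a set variable here, unrelated to the
    later constant of that name.\<close>
  have pair: "(f -` U \<inter> space M) \<inter> (g -` potential_bound \<inter> space M) = (\<lambda>x. (f x, g x)) -` (U \<times> potential_bound) \<inter> space M"
    for f g :: "'a \<Rightarrow> nat \<Rightarrow> real" and U potential_bound by auto
  show ?thesis unfolding 1[symmetric] 2[symmetric] pair by (rule indep_varD[OF ind C' A'])
qed

text \<open>A pi-system argument: the events that depend on finitely many times up to
  \<open>t\<close> are closed under intersection and generate \<open>F t\<close>.\<close>

lemma indep_past:
  assumes t: "0 \<le> t" "t < u" and \<phi>: "\<phi> \<in> borel_measurable (F t)"
  shows "indep_var borel \<phi> borel (\<lambda>\<omega>. B u \<omega> - B t \<omega>)"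
proof -
  let ?\<Delta> = "\<lambda>\<omega>. B u \<omega> - B t \<omega>"
  define X where "X I \<omega> = (\<lambda>s\<in>I. B s \<omega>)" for I \<omega>
  define P where "P I = PiM I (\<lambda>_. borel :: real measure)" for I :: "real set"
  define G where "G = {X I -` C \<inter> space M | I C. finite I \<and> I \<subseteq> {0..t} \<and> C \<in> sets (P I)}"
  define H where "H = {?\<Delta> -` A \<inter> space M | A. A \<in> sets borel}"
  have XM: "X I \<in> measurable M (P I)" if "I \<subseteq> {0..t}" for I
    using that measurable_B unfolding X_def[abs_def] P_def by (intro measurable_restrict) auto
  have rvD: "?\<Delta> \<in> borel_measurable M"
    using t by (intro borel_measurable_diff measurable_B) auto
  have GH: "indep_set G H"
  proof (rule indep_setI)
    show "G \<subseteq> events" using XM by (auto simp: G_def intro: measurable_sets)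
    show "H \<subseteq> events" using rvD by (auto simp: H_def intro: measurable_sets)
    fix a b assume "a \<in> G" "b \<in> H"
    then obtain I C A where *: "finite I" "I \<subseteq> {0..t}" "C \<in> sets (P I)" "A \<in> sets borel"
      "a = X I -` C \<inter> space M" "b = ?\<Delta> -` A \<inter> space M" by (auto simp: G_def H_def)
    then show "prob (a \<inter> b) = prob a * prob b"
      using indep_finite_past[OF *(1,2) t *(3)[unfolded P_def] *(4)] by (simp add: X_def[abs_def])
  qed
  have "Int_stable G"
  proof (rule Int_stableI)
    fix a b assume "a \<in> G" "b \<in> G"
    then obtain I C J C' where *: "finite I" "I \<subseteq> {0..t}" "C \<in> sets (P I)"
        "finite J" "J \<subseteq> {0..t}" "C' \<in> sets (P J)"
        "a = X I -` C \<inter> space M" "b = X J -` C' \<inter> space M" unfolding G_def by blast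
    \<comment> \<open>Both events are rewritten over the union of their index sets, where they can
      be intersected.\<close>
    define E where "E = ((\<lambda>x. restrict x I) -` C \<inter> space (P (I \<union> J))) \<inter> ((\<lambda>x. restrict x J) -` C' \<inter> space (P (I \<union> J)))"
    have "E \<in> sets (P (I \<union> J))" unfolding E_def P_def using * unfolding P_def
      by (intro sets.Int measurable_sets[OF measurable_restrict_subset]) auto
    moreover have "a \<inter> b = X (I \<union> J) -` E \<inter> space M"
    proof -
      have "restrict (X (I \<union> J) \<omega>) I = X I \<omega>" "restrict (X (I \<union> J) \<omega>) J = X J \<omega>"
        "X (I \<union> J) \<omega> \<in> space (P (I \<union> J))" for \<omega>
        by (auto simp: X_def P_def space_PiM fun_eq_iff restrict_def split: if_splits)
      then show ?thesis unfolding *(7,8) E_def by auto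
    qed
    ultimately show "a \<inter> b \<in> G" unfolding G_def using *(1,2,4,5) by blast
  qed
  moreover have "Int_stable H"
  proof (rule Int_stableI)
    fix a b assume "a \<in> H" "b \<in> H"
    then obtain A A' where "A \<in> sets borel" "A' \<in> sets borel"
      "a = ?\<Delta> -` A \<inter> space M" "b = ?\<Delta> -` A' \<inter> space M" unfolding H_def by blast
    then show "a \<inter> b \<in> H" unfolding H_def by (intro CollectI exI[of _ "A \<inter> A'"]) auto
  qed
  ultimately have GH': "indep_set (sigma_sets (space M) G) (sigma_sets (space M) H)"
    using GH by (intro indep_set_sigma_sets)
  have "cylinders (ennreal t) \<subseteq> sigma_sets (space M) G"
  proof
    fix E assume "E \<in> cylinders (ennreal t)"
    then obtain s A where s: "0 \<le> s" "s \<le> t" "A \<in> sets borel" "E = B s -` A \<inter> space M"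
      using t by (auto simp: cylinders_def)
    have "(\<lambda>x. x s) -` A \<inter> space (P {s}) \<in> sets (P {s})" unfolding P_def
      by (rule measurable_sets[OF _ s(3)]) (auto intro: measurable_component_singleton)
    moreover have "E = X {s} -` ((\<lambda>x. x s) -` A \<inter> space (P {s})) \<inter> space M"
      using s by (auto simp: X_def P_def space_PiM)
    moreover have "finite {s}" "{s} \<subseteq> {0..t}" using s by auto
    ultimately have "E \<in> G" unfolding G_def by blast
    then show "E \<in> sigma_sets (space M) G" by blast
  qed
  then have FG: "sets (F t) \<subseteq> sigma_sets (space M) G"
    unfolding sets_filtration by (rule sigma_sets_mono)
  have "\<phi> -` A \<inter> space M \<in> sigma_sets (space M) G" if "A \<in> sets borel" for A
    using FG measurable_sets[OF \<phi> that] by auto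
  then have "sigma_sets (space M) {\<phi> -` A \<inter> space M | A. A \<in> sets borel} \<subseteq> sigma_sets (space M) G"
    by (intro sigma_sets_mono) auto
  then have "indep_set (sigma_sets (space M) {\<phi> -` A \<inter> space M | A. A \<in> sets borel})
      (sigma_sets (space M) {?\<Delta> -` A \<inter> space M | A. A \<in> sets borel})"
    using GH' unfolding H_def[symmetric] indep_sets2_eq by blast
  then show ?thesis unfolding indep_var_eq
    using rvD measurable_from_filtration[OF \<phi>] by auto
qed

section \<open>Moments of Brownian increments and their products with past variables\<close>

lemma increment_moments:
  assumes "0 \<le> s" "s < t"
  shows "integrable M (\<lambda>\<omega>. B t \<omega> - B s \<omega>)" "expectation (\<lambda>\<omega>. B t \<omega> - B s \<omega>) = 0"
    "integrable M (\<lambda>\<omega>. (B t \<omega> - B s \<omega>)\<^sup>2)" "expectation (\<lambda>\<omega>. (B t \<omega> - B s \<omega>)\<^sup>2) = t - s"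
proof -
  note D = normal_increments[OF assms]
  have sg: "0 < sqrt (t - s)" using assms by simp
  show "expectation (\<lambda>\<omega>. B t \<omega> - B s \<omega>) = 0" using normal_distributed_expectation[OF sg D] .
  with normal_distributed_variance[OF sg D] assms
  show "expectation (\<lambda>\<omega>. (B t \<omega> - B s \<omega>)\<^sup>2) = t - s" by simp
  show "integrable M (\<lambda>\<omega>. B t \<omega> - B s \<omega>)"
    using distributed_integrable[OF D, of "\<lambda>x. x"] integrable_normal_moment_nz_1[OF sg, of 0] by simp
  have "integrable lborel (\<lambda>x. normal_density 0 (sqrt (t - s)) x * x\<^sup>2)"
    using integrable.intros[OF normal_moment_even[OF sg, of 0 1]] by simp
  then show "integrable M (\<lambda>\<omega>. (B t \<omega> - B s \<omega>)\<^sup>2)"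
    using distributed_integrable[OF D, of "\<lambda>x. x\<^sup>2"] by simp
qed

lemma integrable_B: "0 \<le> t \<Longrightarrow> integrable M (B t)"
  and integrable_B_square: "0 \<le> t \<Longrightarrow> integrable M (\<lambda>\<omega>. (B t \<omega>)\<^sup>2)"
  and expectation_B_square: "0 \<le> t \<Longrightarrow> expectation (\<lambda>\<omega>. (B t \<omega>)\<^sup>2) = t"
proof -
  assume t: "0 \<le> t"
  have *: "B t \<omega> = B t \<omega> - B 0 \<omega>" if "\<omega> \<in> space M" for \<omega> using B_0[OF that] by simp
  have "integrable M (B t) \<and> integrable M (\<lambda>\<omega>. (B t \<omega>)\<^sup>2) \<and> expectation (\<lambda>\<omega>. (B t \<omega>)\<^sup>2) = t"
  proof (cases "t = 0")
    case True
    have "integrable M (B 0) \<longleftrightarrow> integrable M (\<lambda>_. 0 :: real)"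
      "integrable M (\<lambda>\<omega>. (B 0 \<omega>)\<^sup>2) \<longleftrightarrow> integrable M (\<lambda>_. 0 :: real)"
      "expectation (\<lambda>\<omega>. (B 0 \<omega>)\<^sup>2) = expectation (\<lambda>_. 0)"
      by (intro Bochner_Integration.integrable_cong Bochner_Integration.integral_cong; simp add: B_0)+
    then show ?thesis using True by simp
  next
    case False
    have "integrable M (B t) \<longleftrightarrow> integrable M (\<lambda>\<omega>. B t \<omega> - B 0 \<omega>)"
      "integrable M (\<lambda>\<omega>. (B t \<omega>)\<^sup>2) \<longleftrightarrow> integrable M (\<lambda>\<omega>. (B t \<omega> - B 0 \<omega>)\<^sup>2)"
      "expectation (\<lambda>\<omega>. (B t \<omega>)\<^sup>2) = expectation (\<lambda>\<omega>. (B t \<omega> - B 0 \<omega>)\<^sup>2)"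
      by (intro Bochner_Integration.integrable_cong Bochner_Integration.integral_cong; simp add: B_0)+
    then show ?thesis using increment_moments[of 0 t] t False by simp
  qed
  then show "integrable M (B t)" "integrable M (\<lambda>\<omega>. (B t \<omega>)\<^sup>2)" "expectation (\<lambda>\<omega>. (B t \<omega>)\<^sup>2) = t"
    by auto
qed

text \<open>These identities replace the Ito calculus: the linear term of a step has mean zero, and
  the quadratic term has the mean of \<open>\<phi>\<close> times the length of the step.\<close>

lemma past_times_increment:
  assumes "0 \<le> t" "t < u" "\<phi> \<in> borel_measurable (F t)" "integrable M \<phi>"
  shows "integrable M (\<lambda>\<omega>. \<phi> \<omega> * (B u \<omega> - B t \<omega>))"
    and "expectation (\<lambda>\<omega>. \<phi> \<omega> * (B u \<omega> - B t \<omega>)) = 0"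
    and "integrable M (\<lambda>\<omega>. \<phi> \<omega> * (B u \<omega> - B t \<omega>)\<^sup>2)"
    and "expectation (\<lambda>\<omega>. \<phi> \<omega> * (B u \<omega> - B t \<omega>)\<^sup>2) = (u - t) * expectation \<phi>"
proof -
  note ind = indep_past[OF assms(1-3)]
  note mom = increment_moments[OF assms(1,2)]
  show "integrable M (\<lambda>\<omega>. \<phi> \<omega> * (B u \<omega> - B t \<omega>))"
    "expectation (\<lambda>\<omega>. \<phi> \<omega> * (B u \<omega> - B t \<omega>)) = 0"
    using indep_var_integrable[OF ind assms(4) mom(1)]
      indep_var_lebesgue_integral[OF ind assms(4) mom(1)] mom(2) by auto
  have "indep_var borel ((\<lambda>x. x) \<circ> \<phi>) borel ((\<lambda>x. x\<^sup>2) \<circ> (\<lambda>\<omega>. B u \<omega> - B t \<omega>))"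
    using ind by (rule indep_var_compose) auto
  then have ind2: "indep_var borel \<phi> borel (\<lambda>\<omega>. (B u \<omega> - B t \<omega>)\<^sup>2)" by (simp add: o_def)
  show "integrable M (\<lambda>\<omega>. \<phi> \<omega> * (B u \<omega> - B t \<omega>)\<^sup>2)"
    "expectation (\<lambda>\<omega>. \<phi> \<omega> * (B u \<omega> - B t \<omega>)\<^sup>2) = (u - t) * expectation \<phi>"
    using indep_var_integrable[OF ind2 assms(4) mom(3)]
      indep_var_lebesgue_integral[OF ind2 assms(4) mom(3)] mom(4) by auto
qed

end

subsection \<open>Measurability and second moment of the range\<close>

lemma borel_measurable_gmax:
  "(\<And>j. j \<le> k \<Longrightarrow> Y j \<in> borel_measurable N) \<Longrightarrow> (\<lambda>\<omega>. gmax (\<lambda>j. Y j \<omega>) k) \<in> borel_measurable N"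
  by (induction k) (auto intro!: borel_measurable_max)

lemma integrable_gmax:
  "(\<And>j. j \<le> k \<Longrightarrow> integrable N (Y j)) \<Longrightarrow> integrable N (\<lambda>\<omega>. gmax (\<lambda>j. Y j \<omega>) k)"
  by (induction k) (auto intro!: Bochner_Integration.integrable_max)

text \<open>Measurability is assumed only up to time \<open>t\<close>, so \<open>N\<close> may be a
  member of the filtration.\<close>

lemma borel_measurable_rmax_const:
  assumes Y: "\<And>s. 0 \<le> s \<Longrightarrow> s \<le> t \<Longrightarrow> Y s \<in> borel_measurable N"
    and c: "\<And>\<omega>. \<omega> \<in> space N \<Longrightarrow> continuous_on {0..} (\<lambda>s. Y s \<omega>)" and t: "0 \<le> t"
  shows "(\<lambda>\<omega>. rmax (\<lambda>s. Y s \<omega>) t) \<in> borel_measurable N"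
proof (rule borel_measurable_LIMSEQ_real)
  define h where "h n = 1 / real (Suc n)" for n
  have h: "h n > 0" "h \<longlonglongrightarrow> 0" for n
    unfolding h_def[abs_def] using LIMSEQ_Suc[OF lim_1_over_n] by auto
  show "(\<lambda>n. gmax (\<lambda>j. Y (real j * h n) \<omega>) (nat \<lfloor>t / h n\<rfloor>)) \<longlonglongrightarrow> rmax (\<lambda>s. Y s \<omega>) t"
    if "\<omega> \<in> space N" for \<omega>
    by (rule LIMSEQ_gmax[OF c[OF that] h LIMSEQ_floor_grid[OF t h]])
  show "(\<lambda>\<omega>. gmax (\<lambda>j. Y (real j * h n) \<omega>) (nat \<lfloor>t / h n\<rfloor>)) \<in> borel_measurable N" for n
  proof (intro borel_measurable_gmax Y)
    fix j assume "j \<le> nat \<lfloor>t / h n\<rfloor>"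
    then have "real j * h n \<le> real (nat \<lfloor>t / h n\<rfloor>) * h n"
      using h(1)[of n] by (intro mult_right_mono) auto
    then show "real j * h n \<le> t" using floor_grid_le[OF t h(1), of n] by linarith
  qed (use h(1)[of n] in auto)
qed

text \<open>Rounded down to a grid, \<open>S\<close> takes countably many values, and the rounded
  versions converge by continuity of paths.\<close>

lemma borel_measurable_rmax:
  assumes Y: "\<And>s. 0 \<le> s \<Longrightarrow> Y s \<in> borel_measurable N"
    and c: "\<And>\<omega>. \<omega> \<in> space N \<Longrightarrow> continuous_on {0..} (\<lambda>s. Y s \<omega>)"
    and S [measurable]: "S \<in> borel_measurable N" and S0: "\<And>\<omega>. 0 \<le> S \<omega>"
  shows "(\<lambda>\<omega>. rmax (\<lambda>s. Y s \<omega>) (S \<omega>)) \<in> borel_measurable N"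
proof (rule borel_measurable_LIMSEQ_real)
  define h where "h n = 1 / real (Suc n)" for n
  have h: "h n > 0" "h \<longlonglongrightarrow> 0" for n
    unfolding h_def[abs_def] using LIMSEQ_Suc[OF lim_1_over_n] by auto
  show "(\<lambda>n. gmax (\<lambda>j. Y (real j * h n) \<omega>) (nat \<lfloor>S \<omega> / h n\<rfloor>)) \<longlonglongrightarrow> rmax (\<lambda>s. Y s \<omega>) (S \<omega>)"
    if "\<omega> \<in> space N" for \<omega>
    by (rule LIMSEQ_gmax[OF c[OF that] h LIMSEQ_floor_grid[OF S0 h]])
  show "(\<lambda>\<omega>. gmax (\<lambda>j. Y (real j * h n) \<omega>) (nat \<lfloor>S \<omega> / h n\<rfloor>)) \<in> borel_measurable N" for n
  proof (rule measurable_compose_countable[where f = "\<lambda>k \<omega>. gmax (\<lambda>j. Y (real j * h n) \<omega>) k"])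
    show "(\<lambda>\<omega>. gmax (\<lambda>j. Y (real j * h n) \<omega>) k) \<in> borel_measurable N" for k
      using h(1)[of n] by (intro borel_measurable_gmax Y) auto
  qed measurable
qed

lemma borel_measurable_path_at:
  fixes S :: "'a \<Rightarrow> real"
  assumes Y: "\<And>s. 0 \<le> s \<Longrightarrow> Y s \<in> borel_measurable N"
    and c: "\<And>\<omega>. \<omega> \<in> space N \<Longrightarrow> continuous_on {0..} (\<lambda>s. Y s \<omega> :: real)"
    and S [measurable]: "S \<in> borel_measurable N" and S0: "\<And>\<omega>. 0 \<le> S \<omega>"
  shows "(\<lambda>\<omega>. Y (S \<omega>) \<omega>) \<in> borel_measurable N"
proof (rule borel_measurable_LIMSEQ_real)
  define h where "h n = 1 / real (Suc n)" for n
  have h: "h n > 0" "h \<longlonglongrightarrow> 0" for n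
    unfolding h_def[abs_def] using LIMSEQ_Suc[OF lim_1_over_n] by auto
  show "(\<lambda>n. Y (real (nat \<lfloor>S \<omega> / h n\<rfloor>) * h n) \<omega>) \<longlonglongrightarrow> Y (S \<omega>) \<omega>"
    if "\<omega> \<in> space N" for \<omega>
    using h(1) less_imp_le[OF h(1)] by (intro LIMSEQ_path[OF c[OF that] S0 LIMSEQ_floor_grid[OF S0 h]]) auto
  show "(\<lambda>\<omega>. Y (real (nat \<lfloor>S \<omega> / h n\<rfloor>) * h n) \<omega>) \<in> borel_measurable N" for n
  proof (rule measurable_compose_countable[where f = "\<lambda>k \<omega>. Y (real k * h n) \<omega>"])
    show "Y (real k * h n) \<in> borel_measurable N" for k
      using h(1)[of n] by (intro Y) auto
  qed measurable
qed

lemma borel_measurable_potential_deriv [measurable]: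
  assumes [measurable]: "f \<in> borel_measurable N" "g \<in> borel_measurable N"
  shows "(\<lambda>\<omega>. potential_deriv d (f \<omega>) (g \<omega>)) \<in> borel_measurable N"
  unfolding potential_deriv_def by measurable

context brownian_motion begin

abbreviation range_upto :: "real \<Rightarrow> 'a \<Rightarrow> real" where
  "range_upto t \<omega> \<equiv> rrange (\<lambda>s. B s \<omega>) t"

definition grid :: "real \<Rightarrow> 'a \<Rightarrow> nat \<Rightarrow> real" where
  "grid h \<omega> j = B (real j * h) \<omega>"

lemma borel_measurable_range_upto:
  assumes "S \<in> borel_measurable M" "\<And>\<omega>. 0 \<le> S \<omega>"
  shows "(\<lambda>\<omega>. range_upto (S \<omega>) \<omega>) \<in> borel_measurable M"
  unfolding rrange_def using assms
  by (intro borel_measurable_add borel_measurable_rmax borel_measurable_uminus measurable_B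
      continuous_on_uminus_path continuous_paths)

lemma grid_filtration:
  assumes "h > 0" "j \<le> k"
  shows "(\<lambda>\<omega>. grid h \<omega> j) \<in> borel_measurable (F (real k * h))"
  unfolding grid_def using assms
  by (intro measurable_B_filtration) (auto intro!: ennreal_leI mult_right_mono)

lemma gap_filtration:
  assumes "h > 0"
  shows "(\<lambda>\<omega>. upper_gap (grid h \<omega>) k) \<in> borel_measurable (F (real k * h))"
    "(\<lambda>\<omega>. lower_gap (grid h \<omega>) k) \<in> borel_measurable (F (real k * h))"
  unfolding lower_gap_def upper_gap_def using assms
  by (intro borel_measurable_diff borel_measurable_gmax borel_measurable_uminus grid_filtration; simp)+

text \<open>The expectation of \<open>gmax_square_le\<close>. The values \<open>e = 1\<close> and
  \<open>e = -1\<close> give the maximum and the reflected minimum.\<close>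

lemma gmax_second_moment:
  assumes h: "h > 0"
  shows "integrable M (\<lambda>\<omega>. (gmax (\<lambda>j. e * grid h \<omega> j) k)\<^sup>2)"
    and "expectation (\<lambda>\<omega>. (gmax (\<lambda>j. e * grid h \<omega> j) k)\<^sup>2) \<le> 4 * e\<^sup>2 * (real k * h)"
proof -
  define x where "x \<omega> j = e * grid h \<omega> j" for \<omega> j
  define \<phi> where "\<phi> i \<omega> = - 4 * e * gmax (x \<omega>) i" for i \<omega>
  define R where "R \<omega> = 4 * e\<^sup>2 * (B (real k * h) \<omega>)\<^sup>2 + (\<Sum>i<k. \<phi> i \<omega> * (B (real (Suc i) * h) \<omega> - B (real i * h) \<omega>))" for \<omega>
  have lt: "0 \<le> real i * h" "real i * h < real (Suc i) * h" for i using h by auto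
  have "\<phi> i \<in> borel_measurable (F (real i * h))" for i
    unfolding \<phi>_def[abs_def] x_def
    by (intro borel_measurable_times borel_measurable_const borel_measurable_gmax grid_filtration h)
  moreover have "integrable M (\<phi> i)" for i
    unfolding \<phi>_def[abs_def] x_def grid_def using h
    by (intro integrable_mult_right integrable_gmax integrable_B) auto
  ultimately have \<phi>: "integrable M (\<lambda>\<omega>. \<phi> i \<omega> * (B (real (Suc i) * h) \<omega> - B (real i * h) \<omega>))"
     "expectation (\<lambda>\<omega>. \<phi> i \<omega> * (B (real (Suc i) * h) \<omega> - B (real i * h) \<omega>)) = 0" for i
    using past_times_increment(1,2)[OF lt] by blast+
  have R: "integrable M R"
    unfolding R_def[abs_def] using integrable_B_square[OF lt(1)]
    by (intro Bochner_Integration.integrable_add integrable_mult_right Bochner_Integration.integrable_sum \<phi>) auto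
  have ER: "expectation R = 4 * e\<^sup>2 * (real k * h)"
    unfolding R_def[abs_def] using integrable_B_square[OF lt(1)] expectation_B_square[OF lt(1)] \<phi>
    by (subst Bochner_Integration.integral_add) (auto simp: Bochner_Integration.integral_sum)
  have le: "(gmax (x \<omega>) k)\<^sup>2 \<le> R \<omega>" if "\<omega> \<in> space M" for \<omega>
  proof -
    have "x \<omega> 0 = 0" using B_0[OF that] by (simp add: x_def grid_def)
    have "(\<Sum>i<k. \<phi> i \<omega> * (B (real (Suc i) * h) \<omega> - B (real i * h) \<omega>))
        = - 4 * (\<Sum>i<k. gmax (x \<omega>) i * (x \<omega> (Suc i) - x \<omega> i))"
      unfolding sum_distrib_left \<phi>_def x_def grid_def by (intro sum.cong refl) algebra
    then show ?thesis using gmax_square_le[of "x \<omega>" k, OF \<open>x \<omega> 0 = 0\<close>]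
      by (simp add: R_def x_def grid_def power_mult_distrib)
  qed
  have meas: "(\<lambda>\<omega>. gmax (x \<omega>) k) \<in> borel_measurable M"
    unfolding x_def by (rule measurable_from_filtration[of _ "ennreal (real k * h)"])
      (intro borel_measurable_times borel_measurable_const borel_measurable_gmax grid_filtration h)
  show 1: "integrable M (\<lambda>\<omega>. (gmax (\<lambda>j. e * grid h \<omega> j) k)\<^sup>2)"
    using meas le unfolding x_def
    by (intro Bochner_Integration.integrable_bound[OF R]) (auto intro!: AE_I2 order.trans[OF _ abs_ge_self])
  show "expectation (\<lambda>\<omega>. (gmax (\<lambda>j. e * grid h \<omega> j) k)\<^sup>2) \<le> 4 * e\<^sup>2 * (real k * h)"
    unfolding ER[symmetric] using le unfolding x_def by (intro integral_mono 1 R) auto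
qed

text \<open>The square of a sum is at most twice the sum of the squares, whence 16 = 2 * 4 + 2 *
  4.\<close>

lemma grange_second_moment:
  assumes h: "h > 0"
  shows "integrable M (\<lambda>\<omega>. (grange (grid h \<omega>) k)\<^sup>2)"
    and "expectation (\<lambda>\<omega>. (grange (grid h \<omega>) k)\<^sup>2) \<le> 16 * (real k * h)"
proof -
  let ?f = "\<lambda>e \<omega>. (gmax (\<lambda>j. e * grid h \<omega> j) k)\<^sup>2"
  have le: "(grange (grid h \<omega>) k)\<^sup>2 \<le> 2 * ?f 1 \<omega> + 2 * ?f (-1) \<omega>" for \<omega>
    using sum_squares_bound[of "gmax (grid h \<omega>) k" "gmax (\<lambda>j. - grid h \<omega> j) k"]
    by (simp add: grange_eq power2_sum)
  have R: "integrable M (\<lambda>\<omega>. 2 * ?f 1 \<omega> + 2 * ?f (-1) \<omega>)"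
    by (intro Bochner_Integration.integrable_add integrable_mult_right gmax_second_moment h)
  have meas: "(\<lambda>\<omega>. grange (grid h \<omega>) k) \<in> borel_measurable M"
    unfolding grange_def
    by (intro borel_measurable_add measurable_from_filtration[OF gap_filtration(1)]
        measurable_from_filtration[OF gap_filtration(2)] h)
  show 1: "integrable M (\<lambda>\<omega>. (grange (grid h \<omega>) k)\<^sup>2)"
    using meas le by (intro Bochner_Integration.integrable_bound[OF R])
      (auto intro!: AE_I2 order.trans[OF _ abs_ge_self] simp del: mult_minus1)
  have "expectation (\<lambda>\<omega>. (grange (grid h \<omega>) k)\<^sup>2) \<le> expectation (\<lambda>\<omega>. 2 * ?f 1 \<omega> + 2 * ?f (-1) \<omega>)"
    using le by (intro integral_mono 1 R) auto
  also have "\<dots> = 2 * expectation (?f 1) + 2 * expectation (?f (-1))"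
    using gmax_second_moment(1)[OF h, of 1 k] gmax_second_moment(1)[OF h, of "-1" k]
    by (subst Bochner_Integration.integral_add) auto
  also have "\<dots> \<le> 16 * (real k * h)"
    using gmax_second_moment(2)[OF h, of 1 k] gmax_second_moment(2)[OF h, of "-1" k] by simp
  finally show "expectation (\<lambda>\<omega>. (grange (grid h \<omega>) k)\<^sup>2) \<le> 16 * (real k * h)" .
qed

lemma range_upto_const_measurable: "0 \<le> t \<Longrightarrow> range_upto t \<in> borel_measurable M"
  using borel_measurable_range_upto[of "\<lambda>_. t"] by simp

text \<open>Fatou's lemma along finer grids of \<open>{0..t}\<close>, with the uniform bound
  \<open>16 * t\<close>. This provides the dominating functions for the range and for
  \<open>grid_error\<close>.\<close>

lemma integrable_range_upto_square:
  assumes t: "0 < t" shows "integrable M (\<lambda>\<omega>. (range_upto t \<omega>)\<^sup>2)"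
proof -
  define h where "h n = t / real (Suc n)" for n
  have h: "h n > 0" "h \<longlonglongrightarrow> 0" for n
    unfolding h_def[abs_def] using t LIMSEQ_Suc[OF lim_const_over_n[of t]] by auto
  have Kh: "real (Suc n) * h n = t" for n by (simp add: h_def)
  have lim: "(\<lambda>n. (grange (grid (h n) \<omega>) (Suc n))\<^sup>2) \<longlonglongrightarrow> (range_upto t \<omega>)\<^sup>2" if "\<omega> \<in> space M" for \<omega>
    using LIMSEQ_grange[OF continuous_paths[OF that] h, of "\<lambda>n. Suc n" t]
    unfolding grid_def[abs_def] Kh by (intro tendsto_power) simp
  have "(\<integral>\<^sup>+\<omega>. ennreal ((range_upto t \<omega>)\<^sup>2) \<partial>M)
      = (\<integral>\<^sup>+\<omega>. liminf (\<lambda>n. ennreal ((grange (grid (h n) \<omega>) (Suc n))\<^sup>2)) \<partial>M)"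
  proof (rule nn_integral_cong)
    fix \<omega> assume "\<omega> \<in> space M"
    from tendsto_ennrealI[OF lim[OF this]]
    show "ennreal ((range_upto t \<omega>)\<^sup>2) = liminf (\<lambda>n. ennreal ((grange (grid (h n) \<omega>) (Suc n))\<^sup>2))"
      by (intro lim_imp_Liminf[symmetric]) auto
  qed
  also have "\<dots> \<le> liminf (\<lambda>n. \<integral>\<^sup>+\<omega>. ennreal ((grange (grid (h n) \<omega>) (Suc n))\<^sup>2) \<partial>M)"
    using borel_measurable_integrable[OF grange_second_moment(1)[OF h(1)]]
    by (intro nn_integral_liminf) auto
  also have "\<dots> \<le> liminf (\<lambda>n. ennreal (16 * t))"
  proof (intro Liminf_mono always_eventually allI)
    fix n
    have "(\<integral>\<^sup>+\<omega>. ennreal ((grange (grid (h n) \<omega>) (Suc n))\<^sup>2) \<partial>M)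
        = ennreal (expectation (\<lambda>\<omega>. (grange (grid (h n) \<omega>) (Suc n))\<^sup>2))"
      by (intro nn_integral_eq_integral grange_second_moment h) auto
    then show "(\<integral>\<^sup>+\<omega>. ennreal ((grange (grid (h n) \<omega>) (Suc n))\<^sup>2) \<partial>M) \<le> ennreal (16 * t)"
      using grange_second_moment(2)[OF h(1), of n "Suc n"] unfolding Kh by (simp add: ennreal_leI)
  qed
  also have "\<dots> < \<infinity>" by (simp add: Liminf_const)
  finally show ?thesis using range_upto_const_measurable[of t] t
    by (intro integrableI_nonneg) (auto intro: borel_measurable_power)
qed

lemma range_upto_nonneg: "\<omega> \<in> space M \<Longrightarrow> 0 \<le> t \<Longrightarrow> 0 \<le> range_upto t \<omega>"
  using rrange_nonneg continuous_paths by blast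

lemma integrable_range_upto:
  assumes t: "0 < t" shows "integrable M (range_upto t)"
proof (rule Bochner_Integration.integrable_bound)
  show "integrable M (\<lambda>\<omega>. 1 + (range_upto t \<omega>)\<^sup>2)"
    using integrable_range_upto_square[OF t] by simp
  have "\<bar>x\<bar> \<le> \<bar>1 + x\<^sup>2\<bar>" for x :: real
    using sum_squares_bound[of 1 "\<bar>x\<bar>"] by (simp add: abs_if split: if_splits)
  then show "AE \<omega> in M. norm (range_upto t \<omega>) \<le> norm (1 + (range_upto t \<omega>)\<^sup>2)" by simp
qed (use range_upto_const_measurable[of t] t in auto)

end

subsection \<open>Bounded stopping times\<close>

text \<open>A continuous majorant of \<^const>\<open>potential\<close> that still equals \<open>4d\<close> times the range when \<open>min a b \<ge> d\<close>.\<close>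

definition potential_bound :: "real \<Rightarrow> real \<Rightarrow> real \<Rightarrow> real" where
  "potential_bound d a b = 4 * d * (a + b) + 2 * ((max 0 (d - a))\<^sup>2 + (max 0 (d - b))\<^sup>2)
     + 2 * d * (max 0 (d - a) + max 0 (d - b))"

lemma potential_bound_bounds:
  assumes "d > 0" "a \<ge> 0" "b \<ge> 0"
  shows "0 \<le> potential_bound d a b" "potential_bound d a b \<le> 4 * d * (a + b) + 8 * d\<^sup>2"
proof -
  show "0 \<le> potential_bound d a b" using assms by (auto simp: potential_bound_def intro!: add_nonneg_nonneg mult_nonneg_nonneg)
  have *: "max 0 (d - a) \<le> d" "max 0 (d - b) \<le> d" using assms by auto
  have "(max 0 (d - a))\<^sup>2 \<le> d\<^sup>2" "(max 0 (d - b))\<^sup>2 \<le> d\<^sup>2"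
    by (rule power_mono[OF *(1)] power_mono[OF *(2)], simp)+
  moreover have "d * max 0 (d - a) \<le> d\<^sup>2" "d * max 0 (d - b) \<le> d\<^sup>2"
    using * assms(1) unfolding power2_eq_square by (intro mult_left_mono; simp)+
  ultimately show "potential_bound d a b \<le> 4 * d * (a + b) + 8 * d\<^sup>2" by (simp add: potential_bound_def algebra_simps)
qed

text \<open>With a deterministic bound \<open>T\<close>, every grid quantity is dominated in terms
  of the range up to \<open>T\<close>. General stopping times enter later through
  truncation.\<close>

locale bounded_stopping = brownian_motion M B for M :: "'a measure" and B +
  fixes s :: "'a \<Rightarrow> real" and T :: real
  assumes T_pos: "0 < T"
    and s_nonneg: "\<And>\<omega>. 0 \<le> s \<omega>" and s_le: "\<And>\<omega>. s \<omega> \<le> T"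
    and s_stopping: "\<And>t. 0 \<le> t \<Longrightarrow> {\<omega> \<in> space M. s \<omega> \<le> t} \<in> sets (F t)"
begin

definition mesh :: "nat \<Rightarrow> real" where "mesh n = T / real (Suc n)"

definition steps :: "nat \<Rightarrow> 'a \<Rightarrow> nat" where "steps n \<omega> = nat \<lceil>s \<omega> / mesh n\<rceil>"

abbreviation path :: "nat \<Rightarrow> 'a \<Rightarrow> nat \<Rightarrow> real" where "path n \<equiv> grid (mesh n)"

lemma mesh_pos: "0 < mesh n"
  using T_pos by (simp add: mesh_def)

lemma mesh_LIMSEQ: "mesh \<longlonglongrightarrow> 0"
  unfolding mesh_def[abs_def] using LIMSEQ_Suc[OF lim_const_over_n[of T]] by simp

text \<open>This is why \<open>steps\<close> rounds up: whether step \<open>k\<close> is taken is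
  decided by the path up to the start of that step, so its increment is independent of the
  decision.\<close>

lemma less_steps_iff: "k < steps n \<omega> \<longleftrightarrow> real k * mesh n < s \<omega>"
  unfolding steps_def zless_nat_eq_int_zless less_ceiling_iff
  using pos_less_divide_eq[OF mesh_pos] by auto

lemma steps_le: "steps n \<omega> \<le> Suc n"
proof (rule ccontr)
  assume "\<not> ?thesis"
  then have "Suc n < steps n \<omega>" by simp
  then show False unfolding less_steps_iff using s_le[of \<omega>] by (simp add: mesh_def del: of_nat_Suc)
qed

text \<open>\<open>T\<close> is a grid point of every mesh, so rounding up never passes it.\<close>

lemma steps_times_mesh_le: "real (steps n \<omega>) * mesh n \<le> T"
proof -
  have "real (steps n \<omega>) * mesh n \<le> real (Suc n) * mesh n"
    using steps_le[of n \<omega>] mesh_pos[of n] by (intro mult_right_mono) auto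
  then show ?thesis by (simp add: mesh_def del: of_nat_Suc)
qed

lemma steps_times_mesh_bounds: "s \<omega> \<le> real (steps n \<omega>) * mesh n" "real (steps n \<omega>) * mesh n \<le> s \<omega> + mesh n"
proof -
  show "s \<omega> \<le> real (steps n \<omega>) * mesh n" using less_steps_iff[of "steps n \<omega>" n \<omega>] by simp
  show "real (steps n \<omega>) * mesh n \<le> s \<omega> + mesh n"
    using less_steps_iff[of "steps n \<omega> - 1" n \<omega>] s_nonneg[of \<omega>] mesh_pos[of n]
    by (cases "steps n \<omega>") (auto simp: algebra_simps)
qed

lemma steps_times_mesh_LIMSEQ: "(\<lambda>n. real (steps n \<omega>) * mesh n) \<longlonglongrightarrow> s \<omega>"
proof (rule tendsto_sandwich[of "\<lambda>_. s \<omega>" _ _ "\<lambda>n. s \<omega> + mesh n"])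
  show "(\<lambda>n. s \<omega> + mesh n) \<longlonglongrightarrow> s \<omega>" using tendsto_add[OF tendsto_const mesh_LIMSEQ] by simp
qed (use steps_times_mesh_bounds in auto)

lemma s_measurable [measurable]: "s \<in> borel_measurable M"
proof (rule borel_measurableI_le)
  fix a show "{\<omega> \<in> space M. s \<omega> \<le> a} \<in> sets M"
  proof (cases "0 \<le> a")
    case True
    then show ?thesis using s_stopping[OF True] sets_filtration_subset by blast
  next
    case False
    then have "{\<omega> \<in> space M. s \<omega> \<le> a} = {}" using s_nonneg order.trans by auto
    then show ?thesis by (simp only: sets.empty_sets)
  qed
qed

lemma steps_measurable [measurable]: "steps n \<in> measurable M (count_space UNIV)"
  unfolding steps_def[abs_def] by measurable

lemma s_integrable: "integrable M s"
  using s_nonneg s_le by (intro integrable_const_bound[of _ T]) auto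

lemma steps_times_mesh_integrable: "integrable M (\<lambda>\<omega>. real (steps n \<omega>) * mesh n)"
  using steps_times_mesh_le mesh_pos[of n] by (intro integrable_const_bound[of _ T]) auto

lemma gap_steps_measurable [measurable]:
  "(\<lambda>\<omega>. upper_gap (path n \<omega>) (steps n \<omega>)) \<in> borel_measurable M"
  "(\<lambda>\<omega>. lower_gap (path n \<omega>) (steps n \<omega>)) \<in> borel_measurable M"
  by (rule measurable_compose_countable[OF measurable_from_filtration[OF gap_filtration(1)[OF mesh_pos]] steps_measurable]
      measurable_compose_countable[OF measurable_from_filtration[OF gap_filtration(2)[OF mesh_pos]] steps_measurable])+

lemma gap_measurable [measurable]:
  "(\<lambda>\<omega>. upper_gap (path n \<omega>) k) \<in> borel_measurable M"
  "(\<lambda>\<omega>. lower_gap (path n \<omega>) k) \<in> borel_measurable M"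
  by (rule measurable_from_filtration[OF gap_filtration(1)[OF mesh_pos]]
      measurable_from_filtration[OF gap_filtration(2)[OF mesh_pos]])+

lemma grid_measurable [measurable]: "(\<lambda>\<omega>. path n \<omega> k) \<in> borel_measurable M"
  using mesh_pos[of n] unfolding grid_def by (intro measurable_B) auto

lemma grange_steps_le: "\<omega> \<in> space M \<Longrightarrow> grange (path n \<omega>) (steps n \<omega>) \<le> range_upto T \<omega>"
  unfolding grid_def using steps_times_mesh_le mesh_pos[of n]
  by (intro grange_le_rrange continuous_paths) auto

definition stopped_sum :: "real \<Rightarrow> nat \<Rightarrow> 'a \<Rightarrow> real" where
  "stopped_sum d n \<omega> = (\<Sum>i<steps n \<omega>. potential_deriv d (upper_gap (path n \<omega>) i) (lower_gap (path n \<omega>) i) * (path n \<omega> (Suc i) - path n \<omega> i)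
      + 2 * (path n \<omega> (Suc i) - path n \<omega> i)\<^sup>2)"

text \<open>Optional stopping by hand: the random number of terms becomes \<open>Suc n\<close> terms
  weighted by indicators known at the start of each step. The linear terms vanish in mean and every
  step taken contributes twice the mesh.\<close>

lemma stopped_sum_integral:
  assumes d: "d > 0"
  shows "integrable M (stopped_sum d n)" "expectation (stopped_sum d n) = 2 * expectation (\<lambda>\<omega>. real (steps n \<omega>) * mesh n)"
proof -
  define I where "I i = {\<omega> \<in> space M. real i * mesh n < s \<omega>}" for i
  define \<phi> where "\<phi> i \<omega> = indicator (I i) \<omega> * potential_deriv d (upper_gap (path n \<omega>) i) (lower_gap (path n \<omega>) i)" for i \<omega>
  define \<Delta> where "\<Delta> i \<omega> = B (real (Suc i) * mesh n) \<omega> - B (real i * mesh n) \<omega>" for i \<omega>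
  have lt: "0 \<le> real i * mesh n" "real i * mesh n < real (Suc i) * mesh n" for i using mesh_pos[of n] by auto
  have dt: "real (Suc i) * mesh n - real i * mesh n = mesh n" for i by (simp add: algebra_simps)
  have I: "I i \<in> sets (F (real i * mesh n))" for i
  proof -
    have "I i = space (F (real i * mesh n)) - {\<omega> \<in> space M. s \<omega> \<le> real i * mesh n}"
      by (auto simp: I_def)
    also have "\<dots> \<in> sets (F (real i * mesh n))" using s_stopping[OF lt(1)] by (rule sets.compl_sets)
    finally show ?thesis .
  qed
  have indF: "(indicator (I i) :: 'a \<Rightarrow> real) \<in> borel_measurable (F (real i * mesh n))" for i
    using I by (rule borel_measurable_indicator)
  have indI: "integrable M (indicator (I i) :: 'a \<Rightarrow> real)" for i
    using measurable_from_filtration[OF indF] by (intro integrable_const_bound[of _ 1]) auto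
  have \<phi>F: "\<phi> i \<in> borel_measurable (F (real i * mesh n))" for i
    unfolding \<phi>_def[abs_def] by (intro borel_measurable_times indF borel_measurable_potential_deriv gap_filtration mesh_pos)
  have \<phi>I: "integrable M (\<phi> i)" for i
    using measurable_from_filtration[OF \<phi>F] potential_deriv_bound[OF d gap_nonneg] d
    by (intro integrable_const_bound[of _ "4 * d"]) (auto simp: \<phi>_def indicator_def)
  note 1 = past_times_increment(1,2)[OF lt \<phi>F \<phi>I]
  note 2 = past_times_increment(3,4)[OF lt indF indI, unfolded dt]
  have ind_iff: "indicator (I i) \<omega> = (if i < steps n \<omega> then 1 else 0 :: real)" if "\<omega> \<in> space M" for i \<omega>
    using that by (simp add: I_def less_steps_iff)
  have cut: "(\<Sum>i<steps n \<omega>. f i) = (\<Sum>i<Suc n. indicator (I i) \<omega> * f i)" if "\<omega> \<in> space M" for \<omega> and f :: "nat \<Rightarrow> real"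
    using steps_le[of n \<omega>]
    by (intro sum.mono_neutral_cong_left) (auto simp: ind_iff[OF that])
  have stopped_sum: "stopped_sum d n \<omega> = (\<Sum>i<Suc n. \<phi> i \<omega> * \<Delta> i \<omega> + 2 * (indicator (I i) \<omega> * (\<Delta> i \<omega>)\<^sup>2))"
    if "\<omega> \<in> space M" for \<omega>
    unfolding stopped_sum_def cut[OF that] \<phi>_def \<Delta>_def grid_def by (intro sum.cong refl) algebra
  have Kh: "real (steps n \<omega>) * mesh n = (\<Sum>i<Suc n. mesh n * indicator (I i) \<omega>)" if "\<omega> \<in> space M" for \<omega>
    using cut[OF that, of "\<lambda>_. mesh n"] by (simp add: mult.commute del: sum.lessThan_Suc)
  have "integrable M (\<lambda>\<omega>. \<Sum>i<Suc n. \<phi> i \<omega> * \<Delta> i \<omega> + 2 * (indicator (I i) \<omega> * (\<Delta> i \<omega>)\<^sup>2))"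
    unfolding \<Delta>_def
    by (intro Bochner_Integration.integrable_sum Bochner_Integration.integrable_add integrable_mult_right 1 2)
  then show "integrable M (stopped_sum d n)"
    by (subst Bochner_Integration.integrable_cong[OF refl stopped_sum])
  have "expectation (stopped_sum d n) = expectation (\<lambda>\<omega>. \<Sum>i<Suc n. \<phi> i \<omega> * \<Delta> i \<omega> + 2 * (indicator (I i) \<omega> * (\<Delta> i \<omega>)\<^sup>2))"
    using stopped_sum by (intro Bochner_Integration.integral_cong) auto
  also have "\<dots> = (\<Sum>i<Suc n. expectation (\<lambda>\<omega>. \<phi> i \<omega> * \<Delta> i \<omega> + 2 * (indicator (I i) \<omega> * (\<Delta> i \<omega>)\<^sup>2)))"
    unfolding \<Delta>_def
    by (intro Bochner_Integration.integral_sum Bochner_Integration.integrable_add integrable_mult_right 1 2)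
  also have "\<dots> = (\<Sum>i<Suc n. 2 * (mesh n * expectation (indicator (I i))))"
    unfolding \<Delta>_def
    by (intro sum.cong refl, subst Bochner_Integration.integral_add)
      (simp_all add: 1 2 del: of_nat_Suc)
  also have "\<dots> = 2 * (\<Sum>i<Suc n. expectation (\<lambda>\<omega>. mesh n * indicator (I i) \<omega>))"
    by (simp add: sum_distrib_left del: sum.lessThan_Suc)
  also have "(\<Sum>i<Suc n. expectation (\<lambda>\<omega>. mesh n * indicator (I i) \<omega>)) = expectation (\<lambda>\<omega>. \<Sum>i<Suc n. mesh n * indicator (I i) \<omega>)"
    by (intro Bochner_Integration.integral_sum[symmetric] integrable_mult_right indI)
  also have "\<dots> = expectation (\<lambda>\<omega>. real (steps n \<omega>) * mesh n)"
    using Kh by (intro Bochner_Integration.integral_cong) auto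
  finally show "expectation (stopped_sum d n) = 2 * expectation (\<lambda>\<omega>. real (steps n \<omega>) * mesh n)" .
qed

lemma expectation_steps_times_mesh:
  "expectation s \<le> expectation (\<lambda>\<omega>. real (steps n \<omega>) * mesh n)"
  "expectation (\<lambda>\<omega>. real (steps n \<omega>) * mesh n) \<le> expectation s + mesh n"
proof -
  show "expectation s \<le> expectation (\<lambda>\<omega>. real (steps n \<omega>) * mesh n)"
    using steps_times_mesh_bounds by (intro integral_mono s_integrable steps_times_mesh_integrable)
  have "expectation (\<lambda>\<omega>. real (steps n \<omega>) * mesh n) \<le> expectation (\<lambda>\<omega>. s \<omega> + mesh n)"
    using steps_times_mesh_bounds by (intro integral_mono steps_times_mesh_integrable Bochner_Integration.integrable_add s_integrable) auto
  also have "\<dots> = expectation s + mesh n"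
    using s_integrable by (simp add: prob_space)
  finally show "expectation (\<lambda>\<omega>. real (steps n \<omega>) * mesh n) \<le> expectation s + mesh n" .
qed

lemma range_upto_s_le: "\<omega> \<in> space M \<Longrightarrow> range_upto (s \<omega>) \<omega> \<le> range_upto T \<omega>"
  using rrange_mono[OF continuous_paths s_nonneg s_le] .

lemma integrable_range_upto_s: "integrable M (\<lambda>\<omega>. range_upto (s \<omega>) \<omega>)"
  using range_upto_s_le range_upto_nonneg s_nonneg T_pos range_upto_nonneg
  by (intro Bochner_Integration.integrable_bound[OF integrable_range_upto[OF T_pos]] borel_measurable_range_upto)
     (auto intro!: AE_I2)

lemma expectation_range_le:
  assumes d: "d > 0"
  shows "4 * d * expectation (\<lambda>\<omega>. range_upto (s \<omega>) \<omega>) \<le> 6 * d\<^sup>2 + 2 * expectation s"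
proof -
  have lim: "(\<lambda>n. expectation (\<lambda>\<omega>. grange (path n \<omega>) (steps n \<omega>))) \<longlonglongrightarrow> expectation (\<lambda>\<omega>. range_upto (s \<omega>) \<omega>)"
  proof (rule integral_dominated_convergence[where w = "range_upto T"])
    show "AE \<omega> in M. (\<lambda>n. grange (path n \<omega>) (steps n \<omega>)) \<longlonglongrightarrow> range_upto (s \<omega>) \<omega>"
      unfolding grid_def[abs_def]
      by (intro AE_I2 LIMSEQ_grange continuous_paths mesh_pos mesh_LIMSEQ steps_times_mesh_LIMSEQ)
    show "AE \<omega> in M. norm (grange (path n \<omega>) (steps n \<omega>)) \<le> range_upto T \<omega>" for n
      using grange_steps_le grange_nonneg by (intro AE_I2) auto
    show "(\<lambda>\<omega>. grange (path n \<omega>) (steps n \<omega>)) \<in> borel_measurable M" for n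
      unfolding grange_def by measurable
  qed (use integrable_range_upto[OF T_pos] borel_measurable_range_upto[OF s_measurable s_nonneg] in auto)
  have ineq: "4 * d * expectation (\<lambda>\<omega>. grange (path n \<omega>) (steps n \<omega>)) \<le> 6 * d\<^sup>2 + 2 * (expectation s + mesh n)" for n
  proof -
    have gi: "integrable M (\<lambda>\<omega>. grange (path n \<omega>) (steps n \<omega>))"
      using grange_steps_le grange_nonneg range_upto_nonneg T_pos unfolding grange_def
      by (intro Bochner_Integration.integrable_bound[OF integrable_range_upto[OF T_pos]]) (auto intro!: AE_I2)
    have "4 * d * expectation (\<lambda>\<omega>. grange (path n \<omega>) (steps n \<omega>)) = expectation (\<lambda>\<omega>. 4 * d * grange (path n \<omega>) (steps n \<omega>))"
      by simp
    also have "\<dots> \<le> expectation (\<lambda>\<omega>. 6 * d\<^sup>2 + stopped_sum d n \<omega>)"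
    proof (intro integral_mono)
      show "4 * d * grange (path n \<omega>) (steps n \<omega>) \<le> 6 * d\<^sup>2 + stopped_sum d n \<omega>" for \<omega>
        using potential_ge[OF d] potential_path_le[OF d] unfolding grange_def stopped_sum_def by (rule order.trans)
    qed (use gi stopped_sum_integral[OF d] in auto)
    also have "\<dots> = 6 * d\<^sup>2 + 2 * expectation (\<lambda>\<omega>. real (steps n \<omega>) * mesh n)"
      using stopped_sum_integral[OF d] by (simp add: prob_space)
    also have "\<dots> \<le> 6 * d\<^sup>2 + 2 * (expectation s + mesh n)"
      by (intro add_left_mono mult_left_mono expectation_steps_times_mesh) auto
    finally show ?thesis .
  qed
  have "(\<lambda>n. 6 * d\<^sup>2 + 2 * (expectation s + mesh n)) \<longlonglongrightarrow> 6 * d\<^sup>2 + 2 * (expectation s + 0)"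
    by (intro tendsto_intros mesh_LIMSEQ)
  then show ?thesis
    using LIMSEQ_le[OF tendsto_mult_left[OF lim]] ineq by fastforce
qed

text \<open>\<open>before\<close> says that \<open>s\<close> does not exceed the first time at which
  both gaps reach \<open>d\<close>. Passing to the majorant keeps the direction of a lower
  bound.\<close>

lemma expectation_potential_bound_ge:
  assumes d: "d > 0"
    and before: "\<And>\<omega> r. \<omega> \<in> space M \<Longrightarrow> 0 \<le> r \<Longrightarrow> r < s \<omega> \<Longrightarrow>
      rmax (\<lambda>t. B t \<omega>) r - B r \<omega> < d \<or> rmax (\<lambda>t. - B t \<omega>) r + B r \<omega> < d"
  defines "Vs \<equiv> \<lambda>\<omega>. potential_bound d (rmax (\<lambda>t. B t \<omega>) (s \<omega>) - B (s \<omega>) \<omega>) (rmax (\<lambda>t. - B t \<omega>) (s \<omega>) + B (s \<omega>) \<omega>)"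
  shows "integrable M Vs" "6 * d\<^sup>2 + 2 * expectation s \<le> expectation Vs"
proof -
  let ?Vn = "\<lambda>n \<omega>. potential_bound d (upper_gap (path n \<omega>) (steps n \<omega>)) (lower_gap (path n \<omega>) (steps n \<omega>))"
  let ?err = "\<lambda>n \<omega>. grid_error (path n \<omega>) (steps n \<omega>)"
  have Vn_meas: "?Vn n \<in> borel_measurable M" for n unfolding potential_bound_def by measurable
  have dom: "integrable M (\<lambda>\<omega>. 4 * d * range_upto T \<omega> + 8 * d\<^sup>2)"
    using integrable_range_upto[OF T_pos] by auto
  have Vn_le: "norm (?Vn n \<omega>) \<le> 4 * d * range_upto T \<omega> + 8 * d\<^sup>2" if "\<omega> \<in> space M" for n \<omega>
  proof -
    have "4 * d * (upper_gap (path n \<omega>) (steps n \<omega>) + lower_gap (path n \<omega>) (steps n \<omega>)) \<le> 4 * d * range_upto T \<omega>"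
      using grange_steps_le[OF that, of n] d by (intro mult_left_mono) (auto simp: grange_def)
    then show ?thesis using potential_bound_bounds[OF d gap_nonneg, of "path n \<omega>" "steps n \<omega>" "path n \<omega>" "steps n \<omega>"] by simp
  qed
  have Vn_int: "integrable M (?Vn n)" for n
    by (intro Bochner_Integration.integrable_bound[OF dom Vn_meas] AE_I2)
      (rule order.trans[OF Vn_le], auto)
  have Vs_meas: "Vs \<in> borel_measurable M"
  proof -
    have [measurable]: "(\<lambda>\<omega>. rmax (\<lambda>t. B t \<omega>) (s \<omega>)) \<in> borel_measurable M"
      by (rule borel_measurable_rmax[OF measurable_B continuous_paths s_measurable s_nonneg])
    have [measurable]: "(\<lambda>\<omega>. rmax (\<lambda>t. - B t \<omega>) (s \<omega>)) \<in> borel_measurable M"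
      by (rule borel_measurable_rmax[OF borel_measurable_uminus[OF measurable_B]
            continuous_on_uminus_path[OF continuous_paths] s_measurable s_nonneg])
    have [measurable]: "(\<lambda>\<omega>. B (s \<omega>) \<omega>) \<in> borel_measurable M"
      by (rule borel_measurable_path_at[OF measurable_B continuous_paths s_measurable s_nonneg])
    show ?thesis unfolding Vs_def potential_bound_def by measurable
  qed
  have Vlim: "AE \<omega> in M. (\<lambda>n. ?Vn n \<omega>) \<longlonglongrightarrow> Vs \<omega>"
    unfolding Vs_def potential_bound_def grid_def[abs_def]
    by (intro AE_I2 tendsto_intros LIMSEQ_gap continuous_paths mesh_pos mesh_LIMSEQ steps_times_mesh_LIMSEQ)
  have Vdom: "AE \<omega> in M. norm (?Vn n \<omega>) \<le> 4 * d * range_upto T \<omega> + 8 * d\<^sup>2" for n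
    using Vn_le by (intro AE_I2)
  show "integrable M Vs"
    by (rule integrable_dominated_convergence[OF Vs_meas Vn_meas dom Vlim Vdom])
  have ElimV: "(\<lambda>n. expectation (?Vn n)) \<longlonglongrightarrow> expectation Vs"
    by (rule integral_dominated_convergence[OF Vs_meas Vn_meas dom Vlim Vdom])
  have err_bounds: "0 \<le> ?err n \<omega>" "?err n \<omega> \<le> 2 * (range_upto T \<omega>)\<^sup>2" if "\<omega> \<in> space M" for n \<omega>
    using grid_error_bound[OF continuous_paths[OF that] mesh_pos steps_times_mesh_le]
    unfolding grid_def[abs_def] by auto
  have err_meas: "?err n \<in> borel_measurable M" for n
    by (rule measurable_compose_countable[where f = "\<lambda>k \<omega>. grid_error (path n \<omega>) k"])
      (unfold grid_error_def grange_def, measurable)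
  have err_dom: "integrable M (\<lambda>\<omega>. 2 * (range_upto T \<omega>)\<^sup>2)" using integrable_range_upto_square[OF T_pos] by simp
  have err_int: "integrable M (?err n)" for n
    using err_bounds by (intro Bochner_Integration.integrable_bound[OF err_dom err_meas]) (auto intro!: AE_I2)
  have "(\<lambda>n. expectation (?err n)) \<longlonglongrightarrow> expectation (\<lambda>_. 0)"
  proof (rule integral_dominated_convergence[OF _ err_meas err_dom])
    show "AE \<omega> in M. (\<lambda>n. ?err n \<omega>) \<longlonglongrightarrow> 0"
      unfolding grid_def[abs_def]
      by (intro AE_I2 LIMSEQ_grid_error[where t = T] continuous_paths mesh_pos mesh_LIMSEQ steps_times_mesh_le)
    show "AE \<omega> in M. norm (?err n \<omega>) \<le> 2 * (range_upto T \<omega>)\<^sup>2" for n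
      using err_bounds by (intro AE_I2) auto
  qed auto
  then have ElimE: "(\<lambda>n. expectation (?err n)) \<longlonglongrightarrow> 0" by simp
  have ineq: "6 * d\<^sup>2 + 2 * expectation s \<le> expectation (?Vn n) + 2 * expectation (?err n)" for n
  proof -
    have path: "6 * d\<^sup>2 + stopped_sum d n \<omega> \<le> ?Vn n \<omega> + 2 * ?err n \<omega>" if "\<omega> \<in> space M" for \<omega>
    proof -
      have "6 * d\<^sup>2 + stopped_sum d n \<omega> - 2 * ?err n \<omega> \<le> potential d (upper_gap (path n \<omega>) (steps n \<omega>)) (lower_gap (path n \<omega>) (steps n \<omega>))"
        unfolding stopped_sum_def
      proof (rule potential_path_ge[OF d])
        \<comment> \<open>The strict inequality puts the right end of the step before
          \<open>s\<close>, so the whole step precedes stopping.\<close>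
        fix i assume "Suc i < steps n \<omega>"
        then have lt: "real (Suc i) * mesh n < s \<omega>" unfolding less_steps_iff .
        show "upper_gap (path n \<omega>) i + lower_gap (path n \<omega>) i \<le> 2 * d
          \<or> (upper_gap (path n \<omega>) i < d \<and> upper_gap (path n \<omega>) i - (path n \<omega> (Suc i) - path n \<omega> i) \<le> d)
          \<or> (lower_gap (path n \<omega>) i < d \<and> lower_gap (path n \<omega>) i + (path n \<omega> (Suc i) - path n \<omega> i) \<le> d)"
          unfolding grid_def[abs_def]
          using lt before[OF that]
          by (intro near_extremum_before_stopping continuous_paths that mesh_pos) auto
      qed
      also have "\<dots> \<le> ?Vn n \<omega>"
        using potential_le[OF d gap_nonneg] unfolding potential_bound_def by simp
      finally show ?thesis by simp
    qed
    have "6 * d\<^sup>2 + 2 * expectation s \<le> 6 * d\<^sup>2 + 2 * expectation (\<lambda>\<omega>. real (steps n \<omega>) * mesh n)"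
      using expectation_steps_times_mesh(1) by simp
    also have "\<dots> = expectation (\<lambda>\<omega>. 6 * d\<^sup>2 + stopped_sum d n \<omega>)"
      using stopped_sum_integral[OF d] by (simp add: prob_space)
    also have "\<dots> \<le> expectation (\<lambda>\<omega>. ?Vn n \<omega> + 2 * ?err n \<omega>)"
      using stopped_sum_integral[OF d] Vn_int err_int path
      by (intro integral_mono Bochner_Integration.integrable_add integrable_mult_right) auto
    also have "\<dots> = expectation (?Vn n) + 2 * expectation (?err n)"
      using Vn_int err_int by simp
    finally show ?thesis .
  qed
  have "(\<lambda>n. expectation (?Vn n) + 2 * expectation (?err n)) \<longlonglongrightarrow> expectation Vs + 2 * 0"
    by (intro tendsto_intros ElimV ElimE)
  then show "6 * d\<^sup>2 + 2 * expectation s \<le> expectation Vs"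
    using LIMSEQ_le_const[of _ "expectation Vs"] ineq by auto
qed

end

subsection \<open>Admissible stopping times\<close>

lemma rmax_ge_iff:
  assumes "continuous_on {0..} f" "0 \<le> t"
  shows "d \<le> rmax f t \<longleftrightarrow> (\<exists>r. 0 \<le> r \<and> r \<le> t \<and> d \<le> f r)"
  using rmax_attained[OF assms] rmax_ge[OF assms(1)] order.trans by metis

context brownian_motion begin

section \<open>The drawdown-drawup time as a stopping time\<close>

definition gap_min :: "real \<Rightarrow> 'a \<Rightarrow> real" where
  "gap_min t \<omega> = min (rmax (\<lambda>r. B r \<omega>) t - B t \<omega>) (rmax (\<lambda>r. - B r \<omega>) t + B t \<omega>)"

lemma drawdown_drawup_time_eq:
  "drawdown_drawup_time B d \<omega> = Inf {ennreal t | t. 0 \<le> t \<and> d \<le> gap_min t \<omega>}"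
  by (simp add: drawdown_drawup_time_def gap_min_def running_max_eq running_min_eq add.commute)

lemma continuous_on_gap_min:
  assumes "\<omega> \<in> space M" shows "continuous_on {0..} (\<lambda>t. gap_min t \<omega>)"
  unfolding gap_min_def
  by (intro continuous_intros continuous_on_rmax continuous_on_uminus_path continuous_paths assms)

lemma gap_min_filtration:
  assumes "0 \<le> t" "t \<le> u" shows "gap_min t \<in> borel_measurable (F u)"
proof -
  have B: "B r \<in> borel_measurable (F u)" if "0 \<le> r" "r \<le> t" for r
    using that assms by (intro measurable_B_filtration) (auto intro: ennreal_leI)
  have c: "continuous_on {0..} (\<lambda>r. B r \<omega>)" if "\<omega> \<in> space (F u)" for \<omega>
    using continuous_paths that by simp
  show ?thesis
    unfolding gap_min_def[abs_def]
    using borel_measurable_rmax_const[OF B c assms(1)]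
      borel_measurable_rmax_const[OF borel_measurable_uminus[OF B] continuous_on_uminus_path[OF c] assms(1)]
      B[OF assms(1) order.refl]
    by (intro borel_measurable_min borel_measurable_diff borel_measurable_add)
qed

text \<open>The stopping set is closed by continuity. That both gaps are at least \<open>d\<close>
  at the stopping time itself makes \<open>potential_bound\<close> exact there.\<close>

lemma drawdown_drawup_time_attained:
  assumes \<omega>: "\<omega> \<in> space M" and fin: "drawdown_drawup_time B d \<omega> < \<infinity>"
  obtains r where "0 \<le> r" "d \<le> gap_min r \<omega>" "drawdown_drawup_time B d \<omega> = ennreal r"
proof -
  define S where "S = {r. 0 \<le> r \<and> d \<le> gap_min r \<omega>}"
  have "S = {0..} \<inter> (\<lambda>t. gap_min t \<omega>) -` {d..}" by (auto simp: S_def)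
  then have "closed S"
    using continuous_closed_preimage[OF continuous_on_gap_min[OF \<omega>], of "{d..}"] by simp
  have "S \<noteq> {}"
  proof
    assume "S = {}"
    then have "{ennreal t | t. 0 \<le> t \<and> d \<le> gap_min t \<omega>} = {}" by (auto simp: S_def)
    then have "drawdown_drawup_time B d \<omega> = \<infinity>"
      unfolding drawdown_drawup_time_eq by (simp only: Inf_empty infinity_ennreal_def)
    then show False using fin by simp
  qed
  moreover have bdd: "bdd_below S" by (rule bdd_belowI[of _ 0]) (auto simp: S_def)
  ultimately have S: "Inf S \<in> S" using \<open>closed S\<close> closed_contains_Inf by blast
  have "drawdown_drawup_time B d \<omega> = ennreal (Inf S)"
  proof (rule antisym)
    show "drawdown_drawup_time B d \<omega> \<le> ennreal (Inf S)"
      unfolding drawdown_drawup_time_eq using S by (intro Inf_lower) (auto simp: S_def)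
    show "ennreal (Inf S) \<le> drawdown_drawup_time B d \<omega>"
      unfolding drawdown_drawup_time_eq using bdd
      by (intro Inf_greatest) (auto intro!: ennreal_leI cInf_lower simp: S_def)
  qed
  then show ?thesis using S that by (auto simp: S_def)
qed

text \<open>This reduces the stopping time property to the running maximum of an adapted continuous
  process, which is measurable with respect to the past.\<close>

lemma drawdown_drawup_time_le_iff:
  assumes \<omega>: "\<omega> \<in> space M" and t: "0 \<le> t"
  shows "drawdown_drawup_time B d \<omega> \<le> ennreal t \<longleftrightarrow> d \<le> rmax (\<lambda>r. gap_min r \<omega>) t"
  unfolding rmax_ge_iff[OF continuous_on_gap_min[OF \<omega>] t]
proof
  assume le: "drawdown_drawup_time B d \<omega> \<le> ennreal t"
  then have "drawdown_drawup_time B d \<omega> < \<infinity>" using le_less_trans[OF le] by simp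
  from drawdown_drawup_time_attained[OF \<omega> this] obtain r
    where "0 \<le> r" "d \<le> gap_min r \<omega>" "drawdown_drawup_time B d \<omega> = ennreal r" .
  with le t show "\<exists>r. 0 \<le> r \<and> r \<le> t \<and> d \<le> gap_min r \<omega>" by auto
next
  assume "\<exists>r. 0 \<le> r \<and> r \<le> t \<and> d \<le> gap_min r \<omega>"
  then obtain r where r: "0 \<le> r" "r \<le> t" "d \<le> gap_min r \<omega>" by blast
  then have "drawdown_drawup_time B d \<omega> \<le> ennreal r"
    unfolding drawdown_drawup_time_eq by (intro Inf_lower) auto
  then show "drawdown_drawup_time B d \<omega> \<le> ennreal t" using r(2) order.trans ennreal_leI by blast
qed

lemma stopping_time_drawdown_drawup:
  "stopping_time (natural_filtration M B) (drawdown_drawup_time B d)"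
  unfolding stopping_time_def
proof
  fix t :: ennreal
  show "Measurable.pred (natural_filtration M B t) (\<lambda>\<omega>. drawdown_drawup_time B d \<omega> \<le> t)"
  proof (cases t)
    case (real u)
    have "(\<lambda>\<omega>. rmax (\<lambda>r. gap_min r \<omega>) u) \<in> borel_measurable (F u)"
      using gap_min_filtration continuous_on_gap_min real
      by (intro borel_measurable_rmax_const) auto
    then have "Measurable.pred (F u) (\<lambda>\<omega>. d \<le> rmax (\<lambda>r. gap_min r \<omega>) u)" by measurable
    also have "Measurable.pred (F u) (\<lambda>\<omega>. d \<le> rmax (\<lambda>r. gap_min r \<omega>) u) \<longleftrightarrow>
        Measurable.pred (F u) (\<lambda>\<omega>. drawdown_drawup_time B d \<omega> \<le> t)"
      using drawdown_drawup_time_le_iff real by (intro measurable_cong) auto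
    finally show ?thesis using real by simp
  qed simp
qed

section \<open>Truncation of stopping times\<close>

definition capped :: "('a \<Rightarrow> ennreal) \<Rightarrow> real \<Rightarrow> 'a \<Rightarrow> real" where
  "capped \<tau> T \<omega> = enn2real (min (\<tau> \<omega>) (ennreal T))"

lemma ennreal_capped: "0 \<le> T \<Longrightarrow> ennreal (capped \<tau> T \<omega>) = min (\<tau> \<omega>) (ennreal T)"
  unfolding capped_def by (intro ennreal_enn2real) (simp add: min_less_iff_disj)

lemma bounded_stopping_capped:
  assumes "stopping_time (natural_filtration M B) \<tau>" "0 < T"
  shows "bounded_stopping M B (capped \<tau> T) T"
proof
  show "0 < T" by fact
  show "0 \<le> capped \<tau> T \<omega>" for \<omega> by (simp add: capped_def)
  have le: "capped \<tau> T \<omega> \<le> t \<longleftrightarrow> \<tau> \<omega> \<le> ennreal t \<or> T \<le> t" if "0 \<le> t" for t \<omega>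
    unfolding ennreal_le_iff[OF that, symmetric] using assms(2)
    by (simp add: ennreal_capped min_le_iff_disj)
  show "capped \<tau> T \<omega> \<le> T" for \<omega> using assms(2) le[of T] by simp
  show "{\<omega> \<in> space M. capped \<tau> T \<omega> \<le> t} \<in> sets (F t)" if t: "0 \<le> t" for t
  proof (cases "T \<le> t")
    case True
    then show ?thesis using le[OF t] sets.top[of "F t"] by simp
  next
    case False
    have "Measurable.pred (F t) (\<lambda>\<omega>. \<tau> \<omega> \<le> ennreal t)"
      using assms(1) by (simp add: stopping_time_def)
    then have "{\<omega> \<in> space (F t). \<tau> \<omega> \<le> ennreal t} \<in> sets (F t)" by (rule predE)
    then show ?thesis using False le[OF t] by simp
  qed
qed

lemma stopping_time_measurable:
  assumes "stopping_time (natural_filtration M B) \<tau>"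
  shows "\<tau> \<in> borel_measurable M"
proof (rule borel_measurableI_le)
  fix a
  have "{\<omega> \<in> space (natural_filtration M B a). \<tau> \<omega> \<le> a} \<in> sets (natural_filtration M B a)"
    using assms by (intro predE) (simp add: stopping_time_def)
  then show "{\<omega> \<in> space M. \<tau> \<omega> \<le> a} \<in> sets M" using sets_filtration_subset by auto
qed

text \<open>Sequences along truncations are eventually constant, so their limits require no
  continuity argument.\<close>

lemma capped_eventually:
  assumes "\<tau> \<omega> < \<infinity>"
  shows "\<forall>\<^sub>F n in sequentially. capped \<tau> (real (Suc n)) \<omega> = enn2real (\<tau> \<omega>)"
proof -
  have "\<tau> \<omega> = ennreal (enn2real (\<tau> \<omega>))" using assms by simp
  moreover obtain N where "enn2real (\<tau> \<omega>) \<le> real N" using real_arch_simple by blast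
  ultimately have "\<tau> \<omega> \<le> ennreal (real (Suc n))" if "n \<ge> N" for n
    using that by (metis ennreal_leI of_nat_le_iff order.trans le_Suc_eq)
  then have "capped \<tau> (real (Suc n)) \<omega> = enn2real (\<tau> \<omega>)" if "n \<ge> N" for n
    using that unfolding capped_def by (simp add: min_absorb1)
  then show ?thesis by (auto simp: eventually_sequentially)
qed

lemma capped_le: "\<tau> \<omega> < \<infinity> \<Longrightarrow> capped \<tau> T \<omega> \<le> enn2real (\<tau> \<omega>)"
  unfolding capped_def by (intro enn2real_mono) auto

lemma liminf_nn_integral_le:
  assumes "\<And>n. integrable M (f n)" "\<And>n \<omega>. \<omega> \<in> space M \<Longrightarrow> 0 \<le> f n \<omega>"
    and "\<And>n. expectation (f n) \<le> C"
    and "AE \<omega> in M. (\<lambda>n. ennreal (f n \<omega>)) \<longlonglongrightarrow> g \<omega>"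
  shows "(\<integral>\<^sup>+\<omega>. g \<omega> \<partial>M) \<le> ennreal C"
proof -
  have "(\<integral>\<^sup>+\<omega>. g \<omega> \<partial>M) = (\<integral>\<^sup>+\<omega>. liminf (\<lambda>n. ennreal (f n \<omega>)) \<partial>M)"
    using assms(4) by (intro nn_integral_cong_AE) (auto intro!: lim_imp_Liminf[symmetric])
  also have "\<dots> \<le> liminf (\<lambda>n. \<integral>\<^sup>+\<omega>. ennreal (f n \<omega>) \<partial>M)"
    using borel_measurable_integrable[OF assms(1)] by (intro nn_integral_liminf) auto
  also have "\<dots> \<le> liminf (\<lambda>n. ennreal C)"
  proof (intro Liminf_mono always_eventually allI)
    fix n
    have "(\<integral>\<^sup>+\<omega>. ennreal (f n \<omega>) \<partial>M) = ennreal (expectation (f n))"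
      using assms(2) by (intro nn_integral_eq_integral assms(1)) auto
    then show "(\<integral>\<^sup>+\<omega>. ennreal (f n \<omega>) \<partial>M) \<le> ennreal C" using assms(3) by (simp add: ennreal_leI)
  qed
  also have "\<dots> = ennreal C" by (simp add: Liminf_const)
  finally show ?thesis .
qed

lemma admissible_facts:
  assumes "admissible M B \<tau>"
  shows "AE \<omega> in M. \<tau> \<omega> < \<infinity>" "integrable M (\<lambda>\<omega>. enn2real (\<tau> \<omega>))"
    "(\<integral>\<^sup>+\<omega>. \<tau> \<omega> \<partial>M) = ennreal (expectation (\<lambda>\<omega>. enn2real (\<tau> \<omega>)))"
proof -
  have m [measurable]: "\<tau> \<in> borel_measurable M" and fin: "(\<integral>\<^sup>+\<omega>. \<tau> \<omega> \<partial>M) < \<infinity>"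
    using assms stopping_time_measurable by (auto simp: admissible_def)
  show 1: "AE \<omega> in M. \<tau> \<omega> < \<infinity>"
    using nn_integral_noteq_infinite[OF m] fin by (auto simp: less_top)
  then have eq: "(\<integral>\<^sup>+\<omega>. \<tau> \<omega> \<partial>M) = (\<integral>\<^sup>+\<omega>. ennreal (enn2real (\<tau> \<omega>)) \<partial>M)"
    by (intro nn_integral_cong_AE) auto
  show 2: "integrable M (\<lambda>\<omega>. enn2real (\<tau> \<omega>))"
    using fin unfolding eq by (intro integrableI_nonneg) auto
  show "(\<integral>\<^sup>+\<omega>. \<tau> \<omega> \<partial>M) = ennreal (expectation (\<lambda>\<omega>. enn2real (\<tau> \<omega>)))"
    unfolding eq by (intro nn_integral_eq_integral 2) auto
qed

section \<open>The upper bound for admissible stopping times\<close>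

lemma range_upto_tau_measurable:
  assumes "stopping_time (natural_filtration M B) \<tau>"
  shows "(\<lambda>\<omega>. range_upto (enn2real (\<tau> \<omega>)) \<omega>) \<in> borel_measurable M"
  using stopping_time_measurable[OF assms] by (intro borel_measurable_range_upto) auto

lemma capped_expectation_le:
  assumes adm: "admissible M B \<tau>" and T: "0 < T"
  shows "expectation (capped \<tau> T) \<le> expectation (\<lambda>\<omega>. enn2real (\<tau> \<omega>))"
proof -
  interpret bounded_stopping M B "capped \<tau> T" T
    using adm T by (intro bounded_stopping_capped) (auto simp: admissible_def)
  show ?thesis
    by (intro integral_mono_AE s_integrable admissible_facts[OF adm])
      (use admissible_facts(1)[OF adm] in eventually_elim, rule capped_le)
qed

lemma range_at_admissible:
  assumes adm: "admissible M B \<tau>"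
  shows "integrable M (\<lambda>\<omega>. range_upto (enn2real (\<tau> \<omega>)) \<omega>)"
    and "d > 0 \<Longrightarrow> 4 * d * expectation (\<lambda>\<omega>. range_upto (enn2real (\<tau> \<omega>)) \<omega>)
      \<le> 6 * d\<^sup>2 + 2 * expectation (\<lambda>\<omega>. enn2real (\<tau> \<omega>))"
proof -
  let ?E = "expectation (\<lambda>\<omega>. enn2real (\<tau> \<omega>))"
  have st: "stopping_time (natural_filtration M B) \<tau>" using adm by (simp add: admissible_def)
  have nn: "(\<integral>\<^sup>+\<omega>. ennreal (range_upto (enn2real (\<tau> \<omega>)) \<omega>) \<partial>M) \<le> ennreal ((6 * d\<^sup>2 + 2 * ?E) / (4 * d))"
    if d: "d > 0" for d
  proof (rule liminf_nn_integral_le[where f = "\<lambda>n \<omega>. range_upto (capped \<tau> (real (Suc n)) \<omega>) \<omega>"])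
    fix n
    interpret bounded_stopping M B "capped \<tau> (real (Suc n))" "real (Suc n)"
      using st by (intro bounded_stopping_capped) auto
    show "integrable M (\<lambda>\<omega>. range_upto (capped \<tau> (real (Suc n)) \<omega>) \<omega>)" by (rule integrable_range_upto_s)
    show "0 \<le> range_upto (capped \<tau> (real (Suc n)) \<omega>) \<omega>" if "\<omega> \<in> space M" for \<omega>
      using that s_nonneg by (intro range_upto_nonneg)
    have "expectation (capped \<tau> (real (Suc n))) \<le> ?E"
      using adm by (intro capped_expectation_le) auto
    then show "expectation (\<lambda>\<omega>. range_upto (capped \<tau> (real (Suc n)) \<omega>) \<omega>) \<le> (6 * d\<^sup>2 + 2 * ?E) / (4 * d)"
      using expectation_range_le[OF d] d by (simp add: pos_le_divide_eq mult.commute)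
  next
    show "AE \<omega> in M. (\<lambda>n. ennreal (range_upto (capped \<tau> (real (Suc n)) \<omega>) \<omega>)) \<longlonglongrightarrow> ennreal (range_upto (enn2real (\<tau> \<omega>)) \<omega>)"
      using admissible_facts(1)[OF adm]
    proof eventually_elim
      fix \<omega> assume "\<tau> \<omega> < \<infinity>"
      from capped_eventually[where \<tau> = \<tau>, OF this]
      show "(\<lambda>n. ennreal (range_upto (capped \<tau> (real (Suc n)) \<omega>) \<omega>)) \<longlonglongrightarrow> ennreal (range_upto (enn2real (\<tau> \<omega>)) \<omega>)"
        by (intro tendsto_eventually) (auto elim: eventually_mono)
    qed
  qed
  show int: "integrable M (\<lambda>\<omega>. range_upto (enn2real (\<tau> \<omega>)) \<omega>)"
    \<comment> \<open>For integrability any positive parameter serves.\<close>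
    using nn[of 1] range_upto_tau_measurable[OF st] range_upto_nonneg
    by (intro integrableI_nonneg) (auto intro!: AE_I2 elim: le_less_trans)
  assume d: "d > 0"
  have "ennreal (expectation (\<lambda>\<omega>. range_upto (enn2real (\<tau> \<omega>)) \<omega>)) \<le> ennreal ((6 * d\<^sup>2 + 2 * ?E) / (4 * d))"
    using nn[OF d] range_upto_nonneg by (subst (asm) nn_integral_eq_integral[OF int]) (auto intro!: AE_I2)
  moreover have "0 \<le> (6 * d\<^sup>2 + 2 * ?E) / (4 * d)" using d by simp
  ultimately show "4 * d * expectation (\<lambda>\<omega>. range_upto (enn2real (\<tau> \<omega>)) \<omega>) \<le> 6 * d\<^sup>2 + 2 * ?E"
    using d by (simp add: ennreal_le_iff pos_le_divide_eq mult.commute)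
qed

section \<open>Exact expectations at the drawdown-drawup time\<close>

lemma potential_bound_capped:
  assumes d: "d > 0" and T: "0 < T"
  defines "\<tau> \<equiv> drawdown_drawup_time B d"
  defines "Vc \<equiv> \<lambda>\<omega>. potential_bound d (rmax (\<lambda>t. B t \<omega>) (capped \<tau> T \<omega>) - B (capped \<tau> T \<omega>) \<omega>)
      (rmax (\<lambda>t. - B t \<omega>) (capped \<tau> T \<omega>) + B (capped \<tau> T \<omega>) \<omega>)"
  shows "integrable M Vc" "6 * d\<^sup>2 + 2 * expectation (capped \<tau> T) \<le> expectation Vc"
    "\<And>\<omega>. \<omega> \<in> space M \<Longrightarrow> 0 \<le> Vc \<omega>"
    "\<And>\<omega>. \<omega> \<in> space M \<Longrightarrow> Vc \<omega> \<le> 4 * d * range_upto (capped \<tau> T \<omega>) \<omega> + 8 * d\<^sup>2"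
proof -
  interpret bounded_stopping M B "capped \<tau> T" T
    unfolding \<tau>_def using T stopping_time_drawdown_drawup by (intro bounded_stopping_capped)
  have before: "rmax (\<lambda>t. B t \<omega>) r - B r \<omega> < d \<or> rmax (\<lambda>t. - B t \<omega>) r + B r \<omega> < d"
    if "\<omega> \<in> space M" "0 \<le> r" "r < capped \<tau> T \<omega>" for \<omega> r
  proof (rule ccontr)
    assume "\<not> ?thesis"
    then have "d \<le> gap_min r \<omega>" by (auto simp: gap_min_def)
    then have "\<tau> \<omega> \<le> ennreal r"
      unfolding \<tau>_def drawdown_drawup_time_eq using that(2) by (intro Inf_lower) auto
    then have "ennreal (capped \<tau> T \<omega>) \<le> ennreal r"
      using T by (simp add: ennreal_capped min_le_iff_disj)
    then show False using that by simp
  qed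
  show "integrable M Vc" "6 * d\<^sup>2 + 2 * expectation (capped \<tau> T) \<le> expectation Vc"
    unfolding Vc_def using expectation_potential_bound_ge[OF d before] by auto
  fix \<omega> assume \<omega>: "\<omega> \<in> space M"
  have "0 \<le> rmax (\<lambda>t. B t \<omega>) (capped \<tau> T \<omega>) - B (capped \<tau> T \<omega>) \<omega>"
    "0 \<le> rmax (\<lambda>t. - B t \<omega>) (capped \<tau> T \<omega>) + B (capped \<tau> T \<omega>) \<omega>"
    using rmax_ge[OF continuous_paths[OF \<omega>] s_nonneg[of \<omega>] order.refl]
      rmax_ge[OF continuous_on_uminus_path[OF continuous_paths[OF \<omega>]] s_nonneg[of \<omega>] order.refl]
    by linarith+
  from potential_bound_bounds[OF d this]
  show "0 \<le> Vc \<omega>" "Vc \<omega> \<le> 4 * d * range_upto (capped \<tau> T \<omega>) \<omega> + 8 * d\<^sup>2"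
    by (simp_all add: Vc_def rrange_def)
qed

text \<open>The two bounds with the same parameter would cancel the expected time. Doubling the
  parameter in the upper bound halves its weight there, and a bound on the truncated expectations
  survives.\<close>

lemma admissible_drawdown_drawup_time:
  assumes d: "d > 0"
  shows "admissible M B (drawdown_drawup_time B d)"
proof -
  let ?\<tau> = "drawdown_drawup_time B d"
  have "(\<integral>\<^sup>+\<omega>. ?\<tau> \<omega> \<partial>M) \<le> ennreal (14 * d\<^sup>2)"
  proof (rule liminf_nn_integral_le[where f = "\<lambda>n. capped ?\<tau> (real (Suc n))"])
    fix n
    interpret bounded_stopping M B "capped ?\<tau> (real (Suc n))" "real (Suc n)"
      using stopping_time_drawdown_drawup by (intro bounded_stopping_capped) auto
    show "integrable M (capped ?\<tau> (real (Suc n)))" by (rule s_integrable)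
    show "0 \<le> capped ?\<tau> (real (Suc n)) \<omega>" for \<omega> by (rule s_nonneg)
    let ?E = "expectation (capped ?\<tau> (real (Suc n)))"
    let ?R = "expectation (\<lambda>\<omega>. range_upto (capped ?\<tau> (real (Suc n)) \<omega>) \<omega>)"
    note cap = potential_bound_capped[OF d T_pos]
    have "6 * d\<^sup>2 + 2 * ?E \<le> expectation (\<lambda>\<omega>. 4 * d * range_upto (capped ?\<tau> (real (Suc n)) \<omega>) \<omega> + 8 * d\<^sup>2)"
      using cap integrable_range_upto_s by (intro order.trans[OF cap(2)] integral_mono) auto
    also have "\<dots> = 4 * d * ?R + 8 * d\<^sup>2" using integrable_range_upto_s by (simp add: prob_space)
    finally have "6 * d\<^sup>2 + 2 * ?E \<le> 4 * d * ?R + 8 * d\<^sup>2" .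
    \<comment> \<open>Half of this gives \<open>4 * d * ?R \<le> 12 * d\<^sup>2 + ?E\<close>;
      inserted above it leaves \<open>?E \<le> (12 + 8 - 6) * d\<^sup>2\<close>.\<close>
    moreover have "4 * (2 * d) * ?R \<le> 6 * (2 * d)\<^sup>2 + 2 * ?E"
      using d by (intro expectation_range_le) auto
    ultimately show "?E \<le> 14 * d\<^sup>2" by (simp add: power_mult_distrib)
  next
    show "AE \<omega> in M. (\<lambda>n. ennreal (capped ?\<tau> (real (Suc n)) \<omega>)) \<longlonglongrightarrow> ?\<tau> \<omega>"
    proof (rule AE_I2)
      fix \<omega>
      have "(\<lambda>n. ennreal (real (Suc n))) \<longlonglongrightarrow> \<infinity>"
        using LIMSEQ_Suc[OF of_nat_tendsto_top_ennreal] by (simp add: ennreal_of_nat_eq_real_of_nat)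
      then have "(\<lambda>n. min (?\<tau> \<omega>) (ennreal (real (Suc n)))) \<longlonglongrightarrow> min (?\<tau> \<omega>) \<infinity>"
        by (intro tendsto_min tendsto_const)
      then show "(\<lambda>n. ennreal (capped ?\<tau> (real (Suc n)) \<omega>)) \<longlonglongrightarrow> ?\<tau> \<omega>"
        by (simp add: ennreal_capped)
    qed
  qed
  then show ?thesis using stopping_time_drawdown_drawup
    by (auto simp: admissible_def elim: le_less_trans)
qed

text \<open>Once the truncation is inactive both gaps are at least \<open>d\<close>, the corrections
  in \<open>potential_bound\<close> vanish, and \<open>4 * d\<close> times the range remains. Until
  then they cost at most \<open>8 * d\<^sup>2\<close>, so dominated convergence applies.\<close>

lemma range_at_drawdown_drawup_ge:
  assumes d: "d > 0"
  defines "\<tau> \<equiv> drawdown_drawup_time B d"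
  shows "6 * d\<^sup>2 + 2 * expectation (\<lambda>\<omega>. enn2real (\<tau> \<omega>)) \<le> 4 * d * expectation (\<lambda>\<omega>. range_upto (enn2real (\<tau> \<omega>)) \<omega>)"
proof -
  have adm: "admissible M B \<tau>" unfolding \<tau>_def by (rule admissible_drawdown_drawup_time[OF d])
  then have st: "stopping_time (natural_filtration M B) \<tau>" by (simp add: admissible_def)
  define \<sigma> where "\<sigma> n = capped \<tau> (real (Suc n))" for n
  define Vn where "Vn n \<omega> = potential_bound d (rmax (\<lambda>t. B t \<omega>) (\<sigma> n \<omega>) - B (\<sigma> n \<omega>) \<omega>) (rmax (\<lambda>t. - B t \<omega>) (\<sigma> n \<omega>) + B (\<sigma> n \<omega>) \<omega>)" for n \<omega>
  let ?D = "\<lambda>\<omega>. range_upto (enn2real (\<tau> \<omega>)) \<omega>"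
  have Vn: "integrable M (Vn n)" "6 * d\<^sup>2 + 2 * expectation (\<sigma> n) \<le> expectation (Vn n)" for n
    using potential_bound_capped(1,2)[OF d, of "real (Suc n)"] by (auto simp: \<sigma>_def Vn_def[abs_def] \<tau>_def)
  have Vb: "0 \<le> Vn n \<omega>" "Vn n \<omega> \<le> 4 * d * range_upto (\<sigma> n \<omega>) \<omega> + 8 * d\<^sup>2" if "\<omega> \<in> space M" for n \<omega>
    using potential_bound_capped(3,4)[OF d _ that, of "real (Suc n)"] by (auto simp: \<sigma>_def Vn_def \<tau>_def)
  have \<sigma>0: "0 \<le> \<sigma> n \<omega>" for n \<omega> by (simp add: \<sigma>_def capped_def)
  have "(\<lambda>n. expectation (Vn n)) \<longlonglongrightarrow> expectation (\<lambda>\<omega>. 4 * d * ?D \<omega>)"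
  proof (rule integral_dominated_convergence[where w = "\<lambda>\<omega>. 4 * d * ?D \<omega> + 8 * d\<^sup>2"])
    show "AE \<omega> in M. (\<lambda>n. Vn n \<omega>) \<longlonglongrightarrow> 4 * d * ?D \<omega>"
      using admissible_facts(1)[OF adm] AE_space
    proof eventually_elim
      case (elim \<omega>)
      from drawdown_drawup_time_attained[OF elim(2) elim(1)[unfolded \<tau>_def]] obtain r
        where r: "0 \<le> r" "d \<le> gap_min r \<omega>" "\<tau> \<omega> = ennreal r" unfolding \<tau>_def .
      have "Vn n \<omega> = 4 * d * ?D \<omega>" if "\<sigma> n \<omega> = enn2real (\<tau> \<omega>)" for n
        using r by (simp add: Vn_def that potential_bound_def gap_min_def rrange_def)
      then show ?case using capped_eventually[where \<tau> = \<tau>, OF elim(1)]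
        by (intro tendsto_eventually) (auto elim!: eventually_mono simp: \<sigma>_def)
    qed
    show "AE \<omega> in M. norm (Vn n \<omega>) \<le> 4 * d * ?D \<omega> + 8 * d\<^sup>2" for n
      using admissible_facts(1)[OF adm] AE_space
    proof eventually_elim
      case (elim \<omega>)
      have "range_upto (\<sigma> n \<omega>) \<omega> \<le> ?D \<omega>"
        unfolding \<sigma>_def using capped_le[where \<tau> = \<tau>, OF elim(1)]
        by (intro rrange_mono continuous_paths elim(2)) (simp_all add: capped_def del: of_nat_Suc)
      then have "4 * d * range_upto (\<sigma> n \<omega>) \<omega> \<le> 4 * d * ?D \<omega>" using d by simp
      then show ?case using Vb[OF elim(2), of n] by simp
    qed
  qed (use Vn range_at_admissible(1)[OF adm] range_upto_tau_measurable[OF st] in auto)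
  then have 1: "(\<lambda>n. expectation (Vn n)) \<longlonglongrightarrow> 4 * d * expectation ?D" by simp
  have 2: "(\<lambda>n. expectation (\<sigma> n)) \<longlonglongrightarrow> expectation (\<lambda>\<omega>. enn2real (\<tau> \<omega>))"
  proof (rule integral_dominated_convergence[where w = "\<lambda>\<omega>. enn2real (\<tau> \<omega>)"])
    show "AE \<omega> in M. (\<lambda>n. \<sigma> n \<omega>) \<longlonglongrightarrow> enn2real (\<tau> \<omega>)"
      using admissible_facts(1)[OF adm]
    proof eventually_elim
      case (elim \<omega>)
      then show ?case using capped_eventually[where \<tau> = \<tau>, OF elim(1)]
        by (intro tendsto_eventually) (simp add: \<sigma>_def)
    qed
    show "AE \<omega> in M. norm (\<sigma> n \<omega>) \<le> enn2real (\<tau> \<omega>)" for n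
      using admissible_facts(1)[OF adm]
      by eventually_elim (use \<sigma>0 capped_le[where \<tau> = \<tau>] in \<open>auto simp: \<sigma>_def\<close>)
    show "\<sigma> n \<in> borel_measurable M" for n
      using stopping_time_measurable[OF st] unfolding \<sigma>_def capped_def[abs_def] by measurable
  qed (use admissible_facts(2)[OF adm] in auto)
  show ?thesis
    by (rule LIMSEQ_le[OF tendsto_add[OF tendsto_const tendsto_mult_left[OF 2]] 1]) (use Vn(2) in blast)
qed

lemma drawdown_drawup_expectations:
  assumes d: "d > 0"
  defines "\<tau> \<equiv> drawdown_drawup_time B d"
  shows "expectation (\<lambda>\<omega>. enn2real (\<tau> \<omega>)) = 3 * d\<^sup>2"
    and "expectation (\<lambda>\<omega>. range_upto (enn2real (\<tau> \<omega>)) \<omega>) = 3 * d"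
proof -
  define t where "t = expectation (\<lambda>\<omega>. enn2real (\<tau> \<omega>))"
  define D where "D = expectation (\<lambda>\<omega>. range_upto (enn2real (\<tau> \<omega>)) \<omega>)"
  have le: "4 * e * D \<le> 6 * e\<^sup>2 + 2 * t" if "e > 0" for e
    using range_at_admissible(2)[OF admissible_drawdown_drawup_time[OF d] that]
    by (simp add: t_def D_def \<tau>_def)
  have eq: "4 * d * D = 6 * d\<^sup>2 + 2 * t"
    using le[OF d] range_at_drawdown_drawup_ge[OF d] by (simp add: t_def D_def \<tau>_def)
  \<comment> \<open>Eliminating the expected range between \<open>le\<close> and \<open>eq\<close>
    leaves this quadratic in \<open>e\<close>, with roots \<open>d\<close> and
    \<open>t / (3 * d)\<close>.\<close>
  have key: "0 \<le> (e - d) * (3 * e * d - t)" if "e > 0" for e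
  proof -
    have "e * (4 * d * D) = d * (4 * e * D)" by simp
    also have "\<dots> \<le> d * (6 * e\<^sup>2 + 2 * t)" using le[OF that] d by (intro mult_left_mono) auto
    finally show ?thesis unfolding eq by (simp add: power2_eq_square algebra_simps)
  qed
  have t0: "0 \<le> t" by (simp add: t_def)
  \<comment> \<open>The midpoint of the two roots, where the quadratic is negative unless they
    coincide.\<close>
  define e where "e = (d + t / (3 * d)) / 2"
  have e: "0 < e" using d t0 by (simp add: e_def add_pos_nonneg)
  have "(e - d) * (3 * e * d - t) = - ((t - 3 * d\<^sup>2)\<^sup>2 / (12 * d))"
    using d by (simp add: e_def field_simps power2_eq_square)
  with key[OF e] have "(t - 3 * d\<^sup>2)\<^sup>2 / (12 * d) \<le> 0" by simp
  then have "(t - 3 * d\<^sup>2)\<^sup>2 \<le> 0" using d by (simp add: divide_le_0_iff)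
  then show t: "t = 3 * d\<^sup>2" by simp
  show "D = 3 * d" using eq d unfolding t by (simp add: power2_eq_square)
qed

section \<open>Payoffs and optimality\<close>

lemma payoff_expectation:
  assumes adm: "admissible M B \<tau>"
  shows "integrable M (payoff (running_range B) c \<tau>)"
    and "expectation (payoff (running_range B) c \<tau>) =
      expectation (\<lambda>\<omega>. range_upto (enn2real (\<tau> \<omega>)) \<omega>) - c * expectation (\<lambda>\<omega>. enn2real (\<tau> \<omega>))"
  unfolding payoff_def[abs_def] running_range_eq
  using range_at_admissible(1)[OF adm] admissible_facts(2)[OF adm] by auto

lemma payoff_le:
  assumes adm: "admissible M B \<tau>" and c: "c > 0"
  shows "expectation (payoff (running_range B) c \<tau>) \<le> 3 / (4 * c)"
proof -
  let ?D = "expectation (\<lambda>\<omega>. range_upto (enn2real (\<tau> \<omega>)) \<omega>)"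
  let ?t = "expectation (\<lambda>\<omega>. enn2real (\<tau> \<omega>))"
  \<comment> \<open>With \<open>d = 1 / (2 * c)\<close> the factor \<open>c / 2\<close> is
    \<open>1 / (4 * d)\<close>, which isolates the expected range.\<close>
  have "c / 2 * (4 * (1 / (2 * c)) * ?D) \<le> c / 2 * (6 * (1 / (2 * c))\<^sup>2 + 2 * ?t)"
    using range_at_admissible(2)[OF adm, of "1 / (2 * c)"] c by (intro mult_left_mono) auto
  also have "c / 2 * (4 * (1 / (2 * c)) * ?D) = ?D" using c by simp
  also have "c / 2 * (6 * (1 / (2 * c))\<^sup>2 + 2 * ?t) = 3 / (4 * c) + c * ?t"
    using c by (simp add: power2_eq_square field_simps)
  finally show ?thesis unfolding payoff_expectation(2)[OF adm] by simp
qed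

lemma payoff_drawdown_drawup:
  assumes d: "d > 0"
  shows "expectation (payoff (running_range B) c (drawdown_drawup_time B d)) = 3 * d - 3 * c * d\<^sup>2"
  unfolding payoff_expectation(2)[OF admissible_drawdown_drawup_time[OF d]]
  using drawdown_drawup_expectations[OF d] by simp

end

theorem theorem1:
  fixes M :: "'a measure" and B :: "real \<Rightarrow> 'a \<Rightarrow> real" and c :: real
  assumes "brownian_motion M B"
    and "c > 0"
  shows "optimal M B (running_range B) c (drawdown_drawup_time B (1 / (2 * c))) \<and>
    (\<forall>\<tau>. admissible M B \<tau> \<longrightarrow>
      integrable M (payoff (running_range B) c \<tau>) \<and>
      (\<integral>\<omega>. payoff (running_range B) c \<tau> \<omega> \<partial>M)
        \<le> (\<integral>\<omega>. payoff (running_range B) c (drawdown_drawup_time B (1 / (2 * c))) \<omega> \<partial>M)) \<and>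
    (\<forall>d>0. optimal M B (running_range B) c (drawdown_drawup_time B d) \<longrightarrow> d = 1 / (2 * c)) \<and>
    (\<integral>\<^sup>+ \<omega>. drawdown_drawup_time B (1 / (2 * c)) \<omega> \<partial>M) = ennreal (3 / (4 * c\<^sup>2)) \<and>
    (\<integral>\<omega>. payoff (running_range B) c (drawdown_drawup_time B (1 / (2 * c))) \<omega> \<partial>M) = 3 / (4 * c)"
proof -
  interpret brownian_motion M B by fact
  let ?d = "1 / (2 * c)"
  have d: "?d > 0" using assms(2) by simp
  note adm = admissible_drawdown_drawup_time[OF d]
  have value_eq: "expectation (payoff (running_range B) c (drawdown_drawup_time B ?d)) = 3 / (4 * c)"
    unfolding payoff_drawdown_drawup[OF d] using assms(2) by (simp add: field_simps power2_eq_square)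
  have unique: "e = ?d" if e: "e > 0" and opt: "optimal M B (running_range B) c (drawdown_drawup_time B e)" for e
  proof -
    have "3 / (4 * c) \<le> 3 * e - 3 * c * e\<^sup>2"
      using opt adm value_eq payoff_drawdown_drawup[OF e] by (auto simp: optimal_def)
    then have "3 / (4 * c) * (4 * c) \<le> (3 * e - 3 * c * e\<^sup>2) * (4 * c)"
      using assms(2) by (intro mult_right_mono) auto
    \<comment> \<open>The left side of the previous inequality exceeds its right side by
      \<open>3 * (2 * c * e - 1)\<^sup>2\<close>.\<close>
    then have "(2 * c * e - 1)\<^sup>2 \<le> 0"
      using assms(2) by (simp add: power2_eq_square algebra_simps)
    then have "2 * c * e - 1 = 0" by simp
    then show ?thesis using assms(2) by (simp add: field_simps)
  qed
  have "(\<integral>\<^sup>+ \<omega>. drawdown_drawup_time B ?d \<omega> \<partial>M) = ennreal (3 / (4 * c\<^sup>2))"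
    unfolding admissible_facts(3)[OF adm] drawdown_drawup_expectations(1)[OF d]
    by (simp add: power_divide power_mult_distrib)
  then show ?thesis
    using adm value_eq unique payoff_expectation(1) payoff_le[OF _ assms(2)]
    by (auto simp: optimal_def)
qed

end
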